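(* Let $\mathcal{H}$ be a separable infinite-dimensional Hilbert space and let $A$ and $B$ be two selfadjoint operators on $\mathcal{H}$ which are bounded below. Assume that for some real $a<\inf\big(\sigma(A)\cup\sigma(B)\big)$, \[ \operatorname{D}\big((B-a)^{1/2}\big)=\operatorname{D}\big((A-a)^{1/2}\big) \] and \[ (A-a)^{1/2}\big((B-a)^{-1/2}-(A-a)^{-1/2}\big)\ \text{ is a compact operator on } \mathcal{H}. \] Then $\sigma_{\rm ess}(A,\mathcal{L})=\sigma_{\rm ess}(B,\mathcal{L})$ for every sequence $\mathcal{L}=(\mathcal{L}_n)_{n\in\mathbb{N}}$ of finite-dimensional subspaces which is simultaneously $(A-a)^{1/2}$-regular and $(B-a)^{1/2}$-regular.
   Context: Let $T$ be a selfadjoint operator bounded below and $a<\inf\sigma(T)$. A sequence $\mathcal{L}=(\mathcal{L}_n)_{n\in\mathbb{N}}$ of finite-dimensional subspaces $\mathcal{L}_n\subset\operatorname{D}((T-a)^{1/2})$ is called $(T-a)^{1/2}$-regular if for every $f\in\operatorname{D}((T-a)^{1/2})$ there exist $f_n\in\mathcal{L}_n$ with $\|f_n-f\|+\|(T-a)^{1/2}(f_n-f)\|\to0$ as $n\to\infty$. The compression $T_n:\mathcal{L}_n\to\mathcal{L}_n$ is defined through the quadratic form: for $x\in\mathcal{L}_n$, $T_nx$ is the unique element of $\mathcal{L}_n$ with $\langle y,T_nx\rangle=\langle (T-a)^{1/2}y,(T-a)^{1/2}x\rangle+a\langle y,x\rangle$ for all $y\in\mathcal{L}_n$ (it is the orthogonal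 projection $\pi_n$ onto $\mathcal{L}_n$ applied to $Tx$ understood in the form sense); for $\lambda\in\mathbb{R}$ write $\pi_n(T-\lambda)x:=T_nx-\lambda x$. The limiting spectrum $\sigma(T,\mathcal{L})$ is the set of $\lambda\in\mathbb{R}$ for which there exist $n_k\to\infty$ and $\lambda_k\in\sigma(T_{n_k})$ with $\lambda_k\to\lambda$. The limiting essential spectrum $\sigma_{\rm ess}(T,\mathcal{L})$ is the set of $\lambda\in\mathbb{R}$ for which there exist $n_k\to\infty$ and $x_k\in\mathcal{L}_{n_k}$ with $\|x_k\|=1$, $x_k\rightharpoonup0$ weakly, and $\pi_{n_k}(T-\lambda)x_k\to0$ in norm. *)

theory Defs
  imports "HOL-Analysis.Analysis"
begin

text \<open>A complex Hilbert space is modelled as a real Hilbert space (type class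
  real_inner + complete_space) equipped with a complex structure J (multiplication
  by the imaginary unit). Complex-linear objects are those commuting with J.
  Unbounded operators are pairs (D, T): a domain D and a map T, meaningful on D.\<close>

definition complex_structure :: "('a::real_inner \<Rightarrow> 'a) \<Rightarrow> bool" where
  "complex_structure J \<longleftrightarrow> linear J \<and> (\<forall>x. J (J x) = - x) \<and> (\<forall>x y. inner (J x) (J y) = inner x y)"

definition separable_space :: "'a::real_normed_vector itself \<Rightarrow> bool" where
  "separable_space _ \<longleftrightarrow> (\<exists>C::'a set. countable C \<and> closure C = UNIV)"

definition infinite_dimensional :: "'a::real_vector itself \<Rightarrow> bool" where
  "infinite_dimensional _ \<longleftrightarrow> \<not> (\<exists>B::'a set. finite B \<and> span B = UNIV)"

definition op_linear :: "'a::real_vector set \<Rightarrow> ('a \<Rightarrow> 'a) \<Rightarrow> bool" where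
  "op_linear D T \<longleftrightarrow> subspace D \<and> (\<forall>x\<in>D. \<forall>y\<in>D. T (x + y) = T x + T y)
      \<and> (\<forall>c. \<forall>x\<in>D. T (c *\<^sub>R x) = c *\<^sub>R T x)"

text \<open>Selfadjoint: densely defined, symmetric, and D(T*) is contained in D (so T* = T).\<close>
definition selfadjoint_op :: "'a::real_inner set \<Rightarrow> ('a \<Rightarrow> 'a) \<Rightarrow> bool" where
  "selfadjoint_op D T \<longleftrightarrow> op_linear D T \<and> closure D = UNIV
      \<and> (\<forall>x\<in>D. \<forall>y\<in>D. inner (T x) y = inner x (T y))
      \<and> (\<forall>y z. (\<forall>x\<in>D. inner y (T x) = inner z x) \<longrightarrow> y \<in> D)"

definition commutes_with :: "('a \<Rightarrow> 'a) \<Rightarrow> 'a set \<Rightarrow> ('a \<Rightarrow> 'a) \<Rightarrow> bool" where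
  "commutes_with J D T \<longleftrightarrow> (\<forall>x\<in>D. J x \<in> D \<and> T (J x) = J (T x))"

definition bounded_below_op :: "'a::real_inner set \<Rightarrow> ('a \<Rightarrow> 'a) \<Rightarrow> bool" where
  "bounded_below_op D T \<longleftrightarrow> (\<exists>c. \<forall>x\<in>D. c * (norm x)\<^sup>2 \<le> inner x (T x))"

text \<open>Spectrum (real points; the spectrum of a selfadjoint operator is real).\<close>
definition op_spectrum :: "'a::real_normed_vector set \<Rightarrow> ('a \<Rightarrow> 'a) \<Rightarrow> real set" where
  "op_spectrum D T = {l. \<not> (bij_betw (\<lambda>x. T x - l *\<^sub>R x) D UNIV
      \<and> (\<exists>K. \<forall>x\<in>D. norm x \<le> K * norm (T x - l *\<^sub>R x)))}"

text \<open>The positive selfadjoint square root (T - a)^(1/2) of the operator T - a,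
  normalised to be 0 outside its domain so that it is unique.\<close>
definition op_sqrt :: "'a::real_inner set \<Rightarrow> ('a \<Rightarrow> 'a) \<Rightarrow> real \<Rightarrow> 'a set \<times> ('a \<Rightarrow> 'a)" where
  "op_sqrt D T a = (THE ES. case ES of (E, S) \<Rightarrow>
      selfadjoint_op E S \<and> (\<forall>x\<in>E. 0 \<le> inner x (S x)) \<and> (\<forall>x. x \<notin> E \<longrightarrow> S x = 0)
      \<and> D = {x \<in> E. S x \<in> E} \<and> (\<forall>x\<in>D. S (S x) = T x - a *\<^sub>R x))"

definition sqrt_dom :: "'a::real_inner set \<Rightarrow> ('a \<Rightarrow> 'a) \<Rightarrow> real \<Rightarrow> 'a set" where
  "sqrt_dom D T a = fst (op_sqrt D T a)"

definition sqrt_map :: "'a::real_inner set \<Rightarrow> ('a \<Rightarrow> 'a) \<Rightarrow> real \<Rightarrow> 'a \<Rightarrow> 'a" where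
  "sqrt_map D T a = snd (op_sqrt D T a)"

definition inv_sqrt_map :: "'a::real_inner set \<Rightarrow> ('a \<Rightarrow> 'a) \<Rightarrow> real \<Rightarrow> 'a \<Rightarrow> 'a" where
  "inv_sqrt_map D T a = inv_into (sqrt_dom D T a) (sqrt_map D T a)"

definition compact_operator :: "('a::real_normed_vector \<Rightarrow> 'a) \<Rightarrow> bool" where
  "compact_operator K \<longleftrightarrow> linear K \<and> compact (closure (K ` cball 0 1))"

definition finite_dim_subspace :: "'a::real_vector set \<Rightarrow> bool" where
  "finite_dim_subspace V \<longleftrightarrow> (\<exists>B. finite B \<and> span B = V)"

definition regular_seq :: "'a::real_normed_vector set \<Rightarrow> ('a \<Rightarrow> 'a) \<Rightarrow> (nat \<Rightarrow> 'a set) \<Rightarrow> bool" where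
  "regular_seq E S L \<longleftrightarrow> (\<forall>n. finite_dim_subspace (L n) \<and> L n \<subseteq> E)
     \<and> (\<forall>f\<in>E. \<exists>g. (\<forall>n. g n \<in> L n) \<and> ((\<lambda>n. norm (g n - f) + norm (S (g n - f))) \<longlonglongrightarrow> 0))"

text \<open>The compression T_n of T to L n, defined through the quadratic form.\<close>
definition compression :: "'a::real_inner set \<Rightarrow> ('a \<Rightarrow> 'a) \<Rightarrow> real \<Rightarrow> (nat \<Rightarrow> 'a set) \<Rightarrow> nat \<Rightarrow> 'a \<Rightarrow> 'a" where
  "compression D T a L n x = (THE z. z \<in> L n \<and>
      (\<forall>y\<in>L n. inner y z = inner (sqrt_map D T a y) (sqrt_map D T a x) + a * inner y x))"

definition lim_ess_spec :: "'a::real_inner set \<Rightarrow> ('a \<Rightarrow> 'a) \<Rightarrow> real \<Rightarrow> (nat \<Rightarrow> 'a set) \<Rightarrow> real set" where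
  "lim_ess_spec D T a L = {l. \<exists>n x. filterlim n at_top sequentially
      \<and> (\<forall>k. x k \<in> L (n k) \<and> norm (x k) = 1)
      \<and> (\<forall>y. (\<lambda>k. inner (x k) y) \<longlonglongrightarrow> 0)
      \<and> ((\<lambda>k. compression D T a L (n k) (x k) - l *\<^sub>R x k) \<longlonglongrightarrow> 0)}"

end

theory Submission
  imports Defs
begin

text \<open>
  Write \<open>S\<^sub>A\<close>, \<open>S\<^sub>B\<close> for the two square roots and \<open>K = S\<^sub>A S\<^sub>B\<^sup>-\<^sup>1 - I\<close>, so that
  \<open>S\<^sub>A = S\<^sub>B + K S\<^sub>B\<close> on the common form domain. Let \<open>x\<^sub>k \<in> L\<^sub>n\<close> be a singular sequence for \<open>A\<close> at
  \<open>\<lambda>\<close>, with residual \<open>r\<^sub>k\<close>. Then \<open>S\<^sub>A x\<^sub>k\<close> and \<open>S\<^sub>B x\<^sub>k\<close> are bounded and weakly null. Choose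
  \<open>z\<^sub>k \<in> L\<^sub>n\<close> with \<open>\<langle>S\<^sub>B y, S\<^sub>B z\<^sub>k\<rangle> = (\<lambda> - a) \<langle>y, x\<^sub>k\<rangle>\<close> for all \<open>y \<in> L\<^sub>n\<close>. For \<open>e = z\<^sub>k - x\<^sub>k\<close> and
  \<open>w = S\<^sub>B e\<close>,
  \<open>\<parallel>w\<parallel>\<^sup>2 = \<langle>K w, S\<^sub>A x\<^sub>k\<rangle> + \<langle>w, K S\<^sub>B x\<^sub>k\<rangle> - \<langle>e, r\<^sub>k\<rangle>\<close>,
  and compactness of \<open>K\<close> makes the right-hand side \<open>o(1) \<parallel>w\<parallel>\<close>. Hence \<open>z\<^sub>k - x\<^sub>k \<rightarrow> 0\<close>, and
  \<open>(B\<^sub>n - \<lambda>) z\<^sub>k = (\<lambda> - a) (x\<^sub>k - z\<^sub>k) \<rightarrow> 0\<close>, so the normalised \<open>z\<^sub>k\<close> are singular for \<open>B\<close>.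
  The assumption is symmetric in \<open>A\<close> and \<open>B\<close> because \<open>(I + K)\<^sup>-\<^sup>1 - I = - (I + K)\<^sup>-\<^sup>1 K\<close>.
\<close>

section \<open>Semibounded selfadjoint operators\<close>

text \<open>The parallelogram law, applied with the midpoint of two near-minimisers (which stays in
  \<open>V\<close>), makes a minimising sequence for the distance from \<open>y\<close> Cauchy. Its
  limit is the projection.\<close>

lemma orthogonal_projection_exists:
  fixes V :: "'a::{real_inner, complete_space} set"
  assumes V: "subspace V" and cl: "closed V"
  obtains p where "p \<in> V" "\<And>v. v \<in> V \<Longrightarrow> inner (y - p) v = 0"
proof -
  define d where "d = Inf ((\<lambda>v. (norm (y - v))\<^sup>2) ` V)"
  have ne: "V \<noteq> {}" using V subspace_0 by blast
  have bdd: "bdd_below ((\<lambda>v. (norm (y - v))\<^sup>2) ` V)"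
    by (rule bdd_belowI2[of _ 0]) simp
  have d_le: "d \<le> (norm (y - v))\<^sup>2" if "v \<in> V" for v
    unfolding d_def by (rule cINF_lower[OF bdd that])
  have "\<exists>v\<in>V. (norm (y - v))\<^sup>2 < d + 1 / real (Suc n)" for n
  proof -
    have "d < d + 1 / real (Suc n)" by simp
    then show ?thesis
      unfolding d_def using cINF_less_iff[OF ne bdd] by blast
  qed
  then obtain v where v: "\<And>n. v n \<in> V" "\<And>n. (norm (y - v n))\<^sup>2 < d + 1 / real (Suc n)"
    by metis
  have par: "(norm (v m - v n))\<^sup>2 \<le> 2 / real (Suc m) + 2 / real (Suc n)" for m n
  proof -
    have "(1/2) *\<^sub>R (v m + v n) \<in> V"
      using v(1) V by (simp add: subspace_add subspace_scale)
    then have "d \<le> (norm (y - (1/2) *\<^sub>R (v m + v n)))\<^sup>2" by (rule d_le)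
    moreover have "(norm (v m - v n))\<^sup>2 = 2 * (norm (y - v m))\<^sup>2 + 2 * (norm (y - v n))\<^sup>2
        - 4 * (norm (y - (1/2) *\<^sub>R (v m + v n)))\<^sup>2"
      unfolding power2_norm_eq_inner
      by (simp add: inner_diff_left inner_diff_right inner_add_left inner_add_right inner_commute field_simps)
    ultimately show ?thesis using v(2)[of m] v(2)[of n] by simp
  qed
  have "Cauchy v"
  proof (rule metric_CauchyI)
    fix e :: real assume "e > 0"
    then obtain N where N: "inverse (real (Suc N)) < e\<^sup>2 / 4"
      using reals_Archimedean[of "e\<^sup>2 / 4"] by auto
    have "dist (v m) (v n) < e" if "m \<ge> N" "n \<ge> N" for m n
    proof -
      have "1 / real (Suc k) < e\<^sup>2 / 4" if "k \<ge> N" for k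
      proof -
        have "inverse (real (Suc k)) \<le> inverse (real (Suc N))" using that by simp
        then show ?thesis using N by (simp add: inverse_eq_divide)
      qed
      from this[OF that(1)] this[OF that(2)] par[of m n]
      have "(norm (v m - v n))\<^sup>2 < e\<^sup>2" by simp
      then show ?thesis using \<open>e > 0\<close> by (simp add: dist_norm power_less_imp_less_base)
    qed
    then show "\<exists>M. \<forall>m\<ge>M. \<forall>n\<ge>M. dist (v m) (v n) < e" by blast
  qed
  then obtain p where lim: "v \<longlonglongrightarrow> p" using Cauchy_convergent convergent_def by blast
  have pV: "p \<in> V" using cl v(1) lim closed_sequentially by blast
  have "(norm (y - p))\<^sup>2 \<le> d"
  proof (rule LIMSEQ_le)
    show "(\<lambda>n. (norm (y - v n))\<^sup>2) \<longlonglongrightarrow> (norm (y - p))\<^sup>2"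
      by (intro tendsto_intros lim)
    show "(\<lambda>n. d + 1 / real (Suc n)) \<longlonglongrightarrow> d"
      using tendsto_add[OF tendsto_const LIMSEQ_inverse_real_of_nat, of d]
      by (simp add: inverse_eq_divide)
    show "\<exists>N. \<forall>n\<ge>N. (norm (y - v n))\<^sup>2 \<le> d + 1 / real (Suc n)"
      using v(2) less_imp_le by blast
  qed
  then have min: "(norm (y - p))\<^sup>2 \<le> (norm (y - w))\<^sup>2" if "w \<in> V" for w
    by (rule order_trans[OF _ d_le[OF that]])
  have "inner (y - p) w = 0" if w: "w \<in> V" for w
  proof (cases "w = 0")
    case False
    \<comment> \<open>This \<open>t\<close> minimises the squared norm of
      \<open>(y - p) - t *\<^sub>R w\<close>; minimality of \<open>p\<close> at this single
      competitor forces the inner product to vanish.\<close>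
    define t where "t = inner (y - p) w / inner w w"
    have "p + t *\<^sub>R w \<in> V" using pV w V by (simp add: subspace_add subspace_scale)
    then have "(norm (y - p))\<^sup>2 \<le> (norm ((y - p) - t *\<^sub>R w))\<^sup>2"
      using min by (simp add: algebra_simps)
    also have "\<dots> = (norm (y - p))\<^sup>2 - 2 * t * inner (y - p) w + t * t * inner w w"
      unfolding power2_norm_eq_inner
      by (simp add: inner_diff_left inner_diff_right inner_commute algebra_simps)
    also have "\<dots> = (norm (y - p))\<^sup>2 - (inner (y - p) w)\<^sup>2 / inner w w"
      using False by (simp add: t_def field_simps power2_eq_square)
    finally have "(inner (y - p) w)\<^sup>2 / inner w w \<le> 0" by simp
    moreover have "inner w w > 0" using False by simp
    ultimately show ?thesis by (simp add: divide_le_0_iff)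
  qed simp
  with pV show thesis using that by blast
qed

lemma eq_if_inner_eq_on_dense:
  fixes x y :: "'a::real_inner"
  assumes "closure D = UNIV" and eq: "\<And>v. v \<in> D \<Longrightarrow> inner x v = inner y v"
  shows "x = y"
proof -
  have "closed {v. inner (x - y) v = 0}"
    by (intro closed_Collect_eq continuous_intros)
  moreover have "D \<subseteq> {v. inner (x - y) v = 0}" using eq by (auto simp: inner_diff_left)
  ultimately have "UNIV \<subseteq> {v. inner (x - y) v = 0}"
    using assms(1) closure_minimal by metis
  then have "inner (x - y) (x - y) = 0" by blast
  then show ?thesis by simp
qed

text \<open>The usual discriminant argument, with the form evaluated at
  \<open>x + t *\<^sub>R y\<close>. Since the form may be degenerate, the case where it vanishes at
  \<open>y\<close> is separate.\<close>

lemma psd_Cauchy_Schwarz: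
  fixes R :: "'a::real_inner \<Rightarrow> 'a"
  assumes R: "linear R" and sym: "\<And>x y. inner (R x) y = inner x (R y)"
    and pos: "\<And>x. 0 \<le> inner x (R x)"
  shows "(inner x (R y))\<^sup>2 \<le> inner x (R x) * inner y (R y)"
proof -
  have sc: "inner y (R x) = inner x (R y)" using sym by (metis inner_commute)
  have q: "0 \<le> inner x (R x) + 2 * t * inner x (R y) + t\<^sup>2 * inner y (R y)" for t
    using pos[of "x + t *\<^sub>R y"] sc
    by (simp add: linear_add[OF R] linear_scale[OF R] inner_add_left inner_add_right
        algebra_simps power2_eq_square)
  show ?thesis
  proof (cases "inner y (R y) = 0")
    case True
    have "inner x (R y) = 0"
    proof (rule ccontr)
      assume n: "inner x (R y) \<noteq> 0"
      \<comment> \<open>Here the quadratic is affine in \<open>t\<close>, and the chosen point gives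
        it the value -1.\<close>
      show False using q[of "- (inner x (R x) + 1) / (2 * inner x (R y))"] True n
        by (simp add: field_simps)
    qed
    then show ?thesis using True by simp
  next
    case False
    then have "inner y (R y) > 0" using pos[of y] by simp
    then show ?thesis using q[of "- inner x (R y) / inner y (R y)"]
      by (simp add: field_simps power2_eq_square)
  qed
qed

text \<open>Cauchy-Schwarz for the form of \<open>R\<close>, applied to the pair \<open>R x\<close>,
  \<open>x\<close>, followed by cancelling the squared norm of \<open>R x\<close>. As an operator
  inequality this is \<open>R^2 \<le> c R\<close>.\<close>

lemma psd_norm_bound:
  fixes R :: "'a::real_inner \<Rightarrow> 'a"
  assumes R: "linear R" and sym: "\<And>x y. inner (R x) y = inner x (R y)"
    and pos: "\<And>x. 0 \<le> inner x (R x)" and bd: "\<And>x. inner x (R x) \<le> c * (norm x)\<^sup>2"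
  shows "(norm (R x))\<^sup>2 \<le> c * inner x (R x)"
proof (cases "R x = 0")
  case True
  then show ?thesis by simp
next
  case False
  have "((norm (R x))\<^sup>2)\<^sup>2 = (inner (R x) (R x))\<^sup>2"
    by (simp add: power2_norm_eq_inner)
  also have "\<dots> \<le> inner (R x) (R (R x)) * inner x (R x)"
    by (rule psd_Cauchy_Schwarz[OF R sym pos])
  also have "\<dots> \<le> c * (norm (R x))\<^sup>2 * inner x (R x)"
    by (rule mult_right_mono[OF bd pos])
  finally have "(norm (R x))\<^sup>2 * (norm (R x))\<^sup>2 \<le> (norm (R x))\<^sup>2 * (c * inner x (R x))"
    by (simp add: power2_eq_square algebra_simps)
  moreover have "(norm (R x))\<^sup>2 > 0" using False by simp
  ultimately show ?thesis using mult_le_cancel_left_pos by blast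
qed

section \<open>Coercivity, inverses and spectral lower bounds of selfadjoint operators\<close>

lemma selfadjointD:
  assumes "selfadjoint_op D T"
  shows "subspace D" "closure D = UNIV"
    "\<And>x y. x \<in> D \<Longrightarrow> y \<in> D \<Longrightarrow> T (x + y) = T x + T y"
    "\<And>c x. x \<in> D \<Longrightarrow> T (c *\<^sub>R x) = c *\<^sub>R T x"
    "\<And>x y. x \<in> D \<Longrightarrow> y \<in> D \<Longrightarrow> inner (T x) y = inner x (T y)"
    "\<And>y z. (\<And>x. x \<in> D \<Longrightarrow> inner y (T x) = inner z x) \<Longrightarrow> y \<in> D"
  using assms unfolding selfadjoint_op_def op_linear_def by blast+

lemma selfadjoint_memD:
  assumes T: "selfadjoint_op D T" and eq: "\<And>x. x \<in> D \<Longrightarrow> inner y (T x) = inner z x"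
  shows "y \<in> D" "T y = z"
proof -
  show yD: "y \<in> D" using selfadjointD(6)[OF T] eq by blast
  show "T y = z"
    by (rule eq_if_inner_eq_on_dense[OF selfadjointD(2)[OF T]])
       (use eq selfadjointD(5)[OF T yD] in simp)
qed

lemma selfadjoint_shift:
  assumes T: "selfadjoint_op D T"
  shows "selfadjoint_op D (\<lambda>x. T x - l *\<^sub>R x)"
  unfolding selfadjoint_op_def op_linear_def
proof (intro conjI ballI allI impI)
  fix y z assume "\<forall>x\<in>D. inner y (T x - l *\<^sub>R x) = inner z x"
  then have "inner y (T x) = inner (z + l *\<^sub>R y) x" if "x \<in> D" for x
    using that by (auto simp: inner_diff_right inner_add_left)
  then show "y \<in> D" by (rule selfadjointD(6)[OF T])
qed (use selfadjointD[OF T] in \<open>auto simp: algebra_simps inner_diff_left inner_diff_right\<close>)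

text \<open>Coercivity gives injectivity and, because a selfadjoint operator is closed, closed
  range. A vector orthogonal to the range lies in the kernel of the adjoint, which is
  \<open>T\<close> itself, so it is 0.\<close>

lemma selfadjoint_coercive_bij:
  fixes T :: "'a::{real_inner, complete_space} \<Rightarrow> 'a"
  assumes T: "selfadjoint_op D T" and d: "d > 0"
    and co: "\<And>x. x \<in> D \<Longrightarrow> d * (norm x)\<^sup>2 \<le> inner x (T x)"
  shows "bij_betw T D UNIV" "\<And>x. x \<in> D \<Longrightarrow> d * norm x \<le> norm (T x)"
proof -
  note sub = selfadjointD(1)[OF T] and add = selfadjointD(3)[OF T]
    and scale = selfadjointD(4)[OF T] and sym = selfadjointD(5)[OF T]
  show bd: "d * norm x \<le> norm (T x)" if "x \<in> D" for x
  proof (cases "x = 0")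
    case False
    have "d * norm x * norm x \<le> norm (T x) * norm x"
      using co[OF that] norm_cauchy_schwarz[of x "T x"]
      by (simp add: power2_eq_square algebra_simps)
    then show ?thesis using False by simp
  qed simp
  have diff: "T (x - y) = T x - T y" if "x \<in> D" "y \<in> D" for x y
    using add[of x "(-1) *\<^sub>R y"] scale[of y "-1"] that sub subspace_scale[of D y "-1"] by simp
  have inj: "inj_on T D"
  proof (rule inj_onI)
    fix x y assume "x \<in> D" "y \<in> D" "T x = T y"
    then have "d * norm (x - y) \<le> 0"
      using bd[of "x - y"] diff sub by (simp add: subspace_diff)
    then show "x = y" using d by (simp add: mult_le_0_iff)
  qed
  have subV: "subspace (T ` D)"
  proof (rule subspaceI)
    have "T 0 = 0" using scale[of 0 0] subspace_0[OF sub] by simp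
    then show "0 \<in> T ` D" using subspace_0[OF sub] by (metis imageI)
  next
    fix x y assume "x \<in> T ` D" "y \<in> T ` D"
    then obtain u v where "u \<in> D" "v \<in> D" "x + y = T (u + v)" using add by auto
    then show "x + y \<in> T ` D" using subspace_add[OF sub] by simp
  next
    fix c x assume "x \<in> T ` D"
    then obtain u where "u \<in> D" "c *\<^sub>R x = T (c *\<^sub>R u)" using scale by auto
    then show "c *\<^sub>R x \<in> T ` D" using subspace_scale[OF sub] by simp
  qed
  have "closed (T ` D)"
    unfolding closed_sequential_limits
  proof (intro allI impI, elim conjE)
    fix u y assume u: "\<forall>n. u n \<in> T ` D" and lim: "u \<longlonglongrightarrow> y"
    then obtain x where x: "\<And>n. x n \<in> D" "\<And>n. u n = T (x n)"
      unfolding image_iff by metis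
    have "Cauchy x"
    proof (rule metric_CauchyI)
      fix e :: real assume "e > 0"
      then obtain M where M: "\<And>m n. m \<ge> M \<Longrightarrow> n \<ge> M \<Longrightarrow> dist (u m) (u n) < d * e"
        using metric_CauchyD[OF LIMSEQ_imp_Cauchy[OF lim], of "d * e"] d by auto
      have "dist (x m) (x n) < e" if "m \<ge> M" "n \<ge> M" for m n
      proof -
        have "d * dist (x m) (x n) \<le> dist (u m) (u n)"
          using bd[of "x m - x n"] x diff sub by (simp add: dist_norm subspace_diff)
        also have "\<dots> < d * e" using M that by blast
        finally show ?thesis using d by simp
      qed
      then show "\<exists>M. \<forall>m\<ge>M. \<forall>n\<ge>M. dist (x m) (x n) < e" by blast
    qed
    then obtain w where w: "x \<longlonglongrightarrow> w" using Cauchy_convergent convergent_def by blast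
    \<comment> \<open>Closedness of \<open>T\<close> enters here: the limit \<open>w\<close>
      satisfies the adjoint relation with \<open>y\<close>, hence lies in \<open>D\<close> with
      \<open>T w = y\<close>.\<close>
    have "inner w (T v) = inner y v" if "v \<in> D" for v
    proof (rule LIMSEQ_unique)
      show "(\<lambda>n. inner (x n) (T v)) \<longlonglongrightarrow> inner w (T v)" by (intro tendsto_intros w)
      have "(\<lambda>n. inner (u n) v) \<longlonglongrightarrow> inner y v" by (intro tendsto_intros lim)
      then show "(\<lambda>n. inner (x n) (T v)) \<longlonglongrightarrow> inner y v"
        using sym x that by simp
    qed
    from selfadjoint_memD[OF T this] show "y \<in> T ` D" by blast
  qed
  have "y \<in> T ` D" for y
  proof -
    obtain p where p: "p \<in> T ` D" "\<And>v. v \<in> T ` D \<Longrightarrow> inner (y - p) v = 0"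
      using orthogonal_projection_exists[OF subV \<open>closed (T ` D)\<close>] by blast
    have "inner (y - p) (T x) = inner 0 x" if "x \<in> D" for x using p(2) that by simp
    from selfadjoint_memD[OF T this] have "y - p \<in> D" "T (y - p) = 0" by auto
    then have "norm (y - p) \<le> 0" using bd[of "y - p"] d by (simp add: mult_le_0_iff)
    then show ?thesis using p(1) by simp
  qed
  then show "bij_betw T D UNIV" using inj unfolding bij_betw_def by blast
qed

text \<open>Passing to the inverse trades a partially defined operator for a total linear one, for
  which questions of domain disappear.\<close>

lemma selfadjoint_inverse:
  fixes T :: "'a::{real_inner, complete_space} \<Rightarrow> 'a"
  assumes T: "selfadjoint_op D T" and bij: "bij_betw T D UNIV"
  obtains R where "linear R" "\<And>x y. inner (R x) y = inner x (R y)" "\<And>y. R y \<in> D"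
    "\<And>y. T (R y) = y" "\<And>x. x \<in> D \<Longrightarrow> R (T x) = x"
proof -
  note sub = selfadjointD(1)[OF T] and add = selfadjointD(3)[OF T]
    and scale = selfadjointD(4)[OF T] and sym = selfadjointD(5)[OF T]
  define R where "R = inv_into D T"
  have R1: "R y \<in> D" "T (R y) = y" for y
    using bij unfolding R_def bij_betw_def by (metis UNIV_I inv_into_into, metis UNIV_I f_inv_into_f)
  have R2: "R (T x) = x" if "x \<in> D" for x
    using bij that unfolding R_def bij_betw_def by simp
  have "linear R"
  proof (rule linearI)
    show "R (x + y) = R x + R y" for x y
      using R2[of "R x + R y"] add[of "R x" "R y"] R1 sub by (simp add: subspace_add)
    show "R (c *\<^sub>R x) = c *\<^sub>R R x" for c x
      using R2[of "c *\<^sub>R R x"] scale[of "R x" c] R1 sub by (simp add: subspace_scale)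
  qed
  moreover have "inner (R x) y = inner x (R y)" for x y
    using sym[of "R x" "R y"] R1 by simp
  ultimately show thesis using that R1 R2 by blast
qed

lemma lower_bound_imp_not_in_spectrum:
  fixes T :: "'a::{real_inner, complete_space} \<Rightarrow> 'a"
  assumes T: "selfadjoint_op D T" and c: "\<And>x. x \<in> D \<Longrightarrow> c * (norm x)\<^sup>2 \<le> inner x (T x)"
    and l: "l < c"
  shows "l \<notin> op_spectrum D T"
proof -
  have co: "(c - l) * (norm x)\<^sup>2 \<le> inner x (T x - l *\<^sub>R x)" if "x \<in> D" for x
    using c[OF that] by (simp add: inner_diff_right power2_norm_eq_inner algebra_simps)
  have "c - l > 0" using l by simp
  then have *: "bij_betw (\<lambda>x. T x - l *\<^sub>R x) D UNIV"
    "\<And>x. x \<in> D \<Longrightarrow> (c - l) * norm x \<le> norm (T x - l *\<^sub>R x)"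
    using selfadjoint_coercive_bij[OF selfadjoint_shift[OF T], of "c - l" l] co by blast+
  have "norm x \<le> (1 / (c - l)) * norm (T x - l *\<^sub>R x)" if "x \<in> D" for x
    using *(2)[OF that] l by (simp add: field_simps)
  then show ?thesis using *(1) unfolding op_spectrum_def by blast
qed

text \<open>Let \<open>m\<close> be the best lower bound of the form. If \<open>m \<le> a\<close>,
  then \<open>T - m\<close> has a bounded positive inverse \<open>R\<close> with
  \<open>R^2 \<le> k R\<close>; read on \<open>D\<close>, this says \<open>T - m \<ge> 1/k\<close>,
  contradicting the choice of \<open>m\<close>.\<close>

lemma lower_bound_above_resolvent_halfline:
  fixes T :: "'a::{real_inner, complete_space} \<Rightarrow> 'a"
  assumes T: "selfadjoint_op D T" and bb: "bounded_below_op D T"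
    and nontriv: "\<exists>x::'a. x \<noteq> 0"
    and res: "\<And>l. l \<le> a \<Longrightarrow> l \<notin> op_spectrum D T"
  obtains c where "c > a" "\<And>x. x \<in> D \<Longrightarrow> c * (norm x)\<^sup>2 \<le> inner x (T x)"
proof -
  define C where "C = {c. \<forall>x\<in>D. c * (norm x)\<^sup>2 \<le> inner x (T x)}"
  define m where "m = Sup C"
  have Cne: "C \<noteq> {}" using bb unfolding bounded_below_op_def C_def by blast
  \<comment> \<open>The Rayleigh quotient of one nonzero vector of \<open>D\<close> bounds the set
    of lower bounds from above, so its supremum is meaningful.\<close>
  obtain e :: 'a where e: "e \<in> D" "e \<noteq> 0"
  proof -
    have "\<not> D \<subseteq> {0}"
    proof
      assume "D \<subseteq> {0}"
      then have "closure D \<subseteq> {0}" by (simp add: closure_minimal)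
      then show False using selfadjointD(2)[OF T] nontriv by auto
    qed
    then show thesis using that by auto
  qed
  have "bdd_above C"
  proof (rule bdd_aboveI)
    fix c assume "c \<in> C"
    then have "c * (norm e)\<^sup>2 \<le> inner e (T e)" using e unfolding C_def by blast
    then show "c \<le> inner e (T e) / (norm e)\<^sup>2" using e by (simp add: field_simps)
  qed
  then have ub: "c \<le> m" if "c \<in> C" for c unfolding m_def using that by (simp add: cSup_upper)
  have mb: "m * (norm x)\<^sup>2 \<le> inner x (T x)" if x: "x \<in> D" for x
  proof (cases "x = 0")
    case False
    have "m \<le> inner x (T x) / (norm x)\<^sup>2"
      unfolding m_def
    proof (rule cSup_least[OF Cne])
      fix c assume "c \<in> C"
      then have "c * (norm x)\<^sup>2 \<le> inner x (T x)" using x unfolding C_def by blast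
      then show "c \<le> inner x (T x) / (norm x)\<^sup>2" using False by (simp add: field_simps)
    qed
    then show ?thesis using False by (simp add: field_simps)
  qed simp
  have "m > a"
  proof (rule ccontr)
    assume "\<not> m > a"
    then have "m \<notin> op_spectrum D T" using res by simp
    then obtain K where bij: "bij_betw (\<lambda>x. T x - m *\<^sub>R x) D UNIV"
      and K: "\<And>x. x \<in> D \<Longrightarrow> norm x \<le> K * norm (T x - m *\<^sub>R x)"
      unfolding op_spectrum_def by blast
    obtain R where R: "linear R" "\<And>x y. inner (R x) y = inner x (R y)" "\<And>y. R y \<in> D"
      "\<And>y. T (R y) - m *\<^sub>R R y = y" "\<And>x. x \<in> D \<Longrightarrow> R (T x - m *\<^sub>R x) = x"
      using selfadjoint_inverse[OF selfadjoint_shift[OF T] bij] by metis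
    \<comment> \<open>The maximum with 1 makes the constant positive, as is needed to divide by
      it.\<close>
    define k where "k = max K 1"
    then have k: "k > 0" by simp
    have Kn: "norm (R y) \<le> k * norm y" for y
    proof -
      have "norm (R y) \<le> K * norm y" using K[OF R(3)[of y]] R(4) by simp
      also have "\<dots> \<le> k * norm y" unfolding k_def by (intro mult_right_mono) auto
      finally show ?thesis .
    qed
    have pos: "0 \<le> inner y (R y)" for y
    proof -
      have "0 \<le> inner (R y) (T (R y) - m *\<^sub>R R y)"
        using mb[OF R(3)[of y]] by (simp add: inner_diff_right power2_norm_eq_inner)
      then show ?thesis using R(4) by (simp add: inner_commute)
    qed
    have bd: "inner y (R y) \<le> k * (norm y)\<^sup>2" for y
    proof -
      have "inner y (R y) \<le> norm y * norm (R y)" by (rule norm_cauchy_schwarz)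
      also have "\<dots> \<le> norm y * (k * norm y)" by (intro mult_left_mono Kn) simp
      finally show ?thesis by (simp add: power2_eq_square algebra_simps)
    qed
    have "(m + 1 / k) * (norm x)\<^sup>2 \<le> inner x (T x)" if x: "x \<in> D" for x
    proof -
      \<comment> \<open>The bound \<open>R^2 \<le> k R\<close> is evaluated at
        \<open>(T - m) x\<close>, where \<open>R\<close> returns \<open>x\<close>.\<close>
      have "(norm x)\<^sup>2 \<le> k * inner (T x - m *\<^sub>R x) x"
        using psd_norm_bound[OF R(1,2) pos bd, of "T x - m *\<^sub>R x"] R(5)[OF x] by simp
      also have "\<dots> = k * (inner x (T x) - m * (norm x)\<^sup>2)"
        by (simp add: inner_diff_right power2_norm_eq_inner inner_commute[of "T x - m *\<^sub>R x" x])
      finally have "(norm x)\<^sup>2 / k \<le> inner x (T x) - m * (norm x)\<^sup>2"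
        using k by (simp only: pos_divide_le_eq mult.commute)
      then show ?thesis by (simp add: distrib_right)
    qed
    then have "m + 1 / k \<in> C" unfolding C_def by blast
    from ub[OF this] show False unfolding k_def by (simp add: field_simps)
  qed
  then show thesis using that mb by blast
qed

section \<open>Square roots\<close>

text \<open>
  The iteration \<open>X\<^sub>0 = 0\<close>, \<open>X\<^sub>n\<^sub>+\<^sub>1 = (Y + X\<^sub>n\<^sup>2) / 2\<close> tends to \<open>1 - (1 - Y)\<^sup>1\<^sup>/\<^sup>2\<close> for a contraction
  \<open>Y\<close>. Its increments are dominated in norm by those of the scalar iteration with \<open>Y = 1\<close>,
  so no order completeness of the selfadjoint operators is needed.
\<close>

primrec sqrt_iter :: "('a::real_vector \<Rightarrow> 'a) \<Rightarrow> nat \<Rightarrow> 'a \<Rightarrow> 'a" where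
  "sqrt_iter Y 0 x = 0"
| "sqrt_iter Y (Suc n) x = (1/2) *\<^sub>R (Y x + sqrt_iter Y n (sqrt_iter Y n x))"

primrec sqrt_majorant :: "nat \<Rightarrow> real" where
  "sqrt_majorant 0 = 0"
| "sqrt_majorant (Suc n) = (1 + (sqrt_majorant n)\<^sup>2) / 2"

lemma sqrt_majorant_bounds: "0 \<le> sqrt_majorant n" "sqrt_majorant n \<le> 1"
proof (induction n)
  case (Suc n)
  { case 1 show ?case by simp }
  { case 2
    have "(sqrt_majorant n)\<^sup>2 \<le> 1" using Suc by (simp add: power_le_one)
    then show ?case by simp }
qed auto

lemma sqrt_majorant_mono: "sqrt_majorant n \<le> sqrt_majorant (Suc n)"
proof -
  have "0 \<le> (1 - sqrt_majorant n)\<^sup>2" by simp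
  then show ?thesis by (simp add: power2_eq_square algebra_simps)
qed

lemma linear_sqrt_iter:
  assumes Y: "linear Y" shows "linear (sqrt_iter Y n)"
proof (induction n)
  case 0
  show ?case by (rule linearI) simp_all
next
  case (Suc n)
  show ?case
    by (rule linearI) (simp_all add: linear_add[OF Y] linear_add[OF Suc] linear_scale[OF Y]
        linear_scale[OF Suc] algebra_simps)
qed

lemma sqrt_iter_symmetric:
  assumes "\<And>x y. inner (Y x) y = inner x (Y y)"
  shows "inner (sqrt_iter Y n x) y = inner x (sqrt_iter Y n y)"
  by (induction n arbitrary: x y) (simp_all add: assms inner_add_left inner_add_right)

text \<open>Every iterate is a polynomial in \<open>Y\<close>. In the limit this yields the
  commutation property on which uniqueness of the square root rests.\<close>

lemma sqrt_iter_commute: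
  assumes P: "linear P" and "\<And>x. P (Y x) = Y (P x)"
  shows "P (sqrt_iter Y n x) = sqrt_iter Y n (P x)"
  by (induction n arbitrary: x)
     (simp_all add: assms linear_0[OF P] linear_add[OF P] linear_scale[OF P])

lemma norm_sqrt_iter_le:
  assumes Y: "\<And>x. norm (Y x) \<le> norm x"
  shows "norm (sqrt_iter Y n x) \<le> sqrt_majorant n * norm x"
proof (induction n arbitrary: x)
  case (Suc n)
  have "norm (sqrt_iter Y n (sqrt_iter Y n x)) \<le> sqrt_majorant n * (sqrt_majorant n * norm x)"
    by (rule order_trans[OF Suc mult_left_mono[OF Suc sqrt_majorant_bounds(1)]])
  then have "norm (Y x + sqrt_iter Y n (sqrt_iter Y n x))
      \<le> norm x + sqrt_majorant n * (sqrt_majorant n * norm x)"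
    using Y[of x] norm_triangle_ineq[of "Y x" "sqrt_iter Y n (sqrt_iter Y n x)"] by linarith
  moreover have "norm (sqrt_iter Y (Suc n) x)
      = (1/2) * norm (Y x + sqrt_iter Y n (sqrt_iter Y n x))" by simp
  ultimately show ?case by (simp del: sqrt_iter.simps add: power2_eq_square field_simps)
qed simp

text \<open>Write \<open>X'\<close> for the iterate after \<open>X\<close>. The difference of
  squares splits as \<open>(X' - X) X' + X (X' - X)\<close>, without any use of commutativity. The
  two norm bounds add up to the difference of the squared majorants, twice the next scalar
  increment.\<close>

lemma norm_sqrt_iter_diff_Suc:
  assumes lin: "linear Y" and Y: "\<And>x. norm (Y x) \<le> norm x"
  shows "norm (sqrt_iter Y (Suc n) x - sqrt_iter Y n x)
    \<le> (sqrt_majorant (Suc n) - sqrt_majorant n) * norm x"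
proof (induction n arbitrary: x)
  case 0
  show ?case using Y[of x] by simp
next
  case (Suc n)
  let ?X = "sqrt_iter Y" and ?q = sqrt_majorant
  let ?u = "?X (Suc n) (?X (Suc n) x) - ?X n (?X (Suc n) x)"
  let ?v = "?X n (?X (Suc n) x - ?X n x)"
  note dq = sqrt_majorant_mono[of n] and q0 = sqrt_majorant_bounds(1)
  have "norm ?u \<le> (?q (Suc n) - ?q n) * norm (?X (Suc n) x)" by (rule Suc)
  also have "\<dots> \<le> (?q (Suc n) - ?q n) * (?q (Suc n) * norm x)"
    by (intro mult_left_mono norm_sqrt_iter_le[OF Y]) (use dq in simp)
  finally have u: "norm ?u \<le> (?q (Suc n) - ?q n) * (?q (Suc n) * norm x)" .
  have "norm ?v \<le> ?q n * norm (?X (Suc n) x - ?X n x)" by (rule norm_sqrt_iter_le[OF Y])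
  also have "\<dots> \<le> ?q n * ((?q (Suc n) - ?q n) * norm x)"
    by (intro mult_left_mono Suc q0)
  finally have v: "norm ?v \<le> ?q n * ((?q (Suc n) - ?q n) * norm x)" .
  have "?X (Suc (Suc n)) x - ?X (Suc n) x
      = (1/2) *\<^sub>R (Y x + ?X (Suc n) (?X (Suc n) x)) - (1/2) *\<^sub>R (Y x + ?X n (?X n x))"
    by (intro arg_cong2[of _ _ _ _ minus] sqrt_iter.simps(2))
  also have "\<dots> = (1/2) *\<^sub>R (?X (Suc n) (?X (Suc n) x) - ?X n (?X n x))"
    by (simp only: add_diff_cancel_left flip: scaleR_diff_right)
  also have "\<dots> = (1/2) *\<^sub>R (?u + ?v)"
    by (simp del: sqrt_iter.simps add: linear_diff[OF linear_sqrt_iter[OF lin]])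
  finally have "?X (Suc (Suc n)) x - ?X (Suc n) x = (1/2) *\<^sub>R (?u + ?v)" .
  then have "norm (?X (Suc (Suc n)) x - ?X (Suc n) x) \<le> (1/2) * (norm ?u + norm ?v)"
    using norm_triangle_ineq[of ?u ?v] by simp
  also have "\<dots> \<le> (1/2) * ((?q (Suc n) - ?q n) * (?q (Suc n) * norm x)
      + ?q n * ((?q (Suc n) - ?q n) * norm x))"
    using u v by simp
  also have "\<dots> = (1/2) * ((?q (Suc n))\<^sup>2 - (?q n)\<^sup>2) * norm x"
    by (simp only: power2_eq_square algebra_simps)
  also have "(1/2) * ((?q (Suc n))\<^sup>2 - (?q n)\<^sup>2) = ?q (Suc (Suc n)) - ?q (Suc n)"
  proof -
    have "?q (Suc (Suc n)) - ?q (Suc n) = (1 + (?q (Suc n))\<^sup>2) / 2 - (1 + (?q n)\<^sup>2) / 2"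
      by (intro arg_cong2[of _ _ _ _ minus] sqrt_majorant.simps(2))
    moreover have "(1/2) * (s - t) = (1 + s) / 2 - (1 + t) / 2" for s t :: real
      by (simp add: field_simps)
    ultimately show ?thesis by (simp only:)
  qed
  finally show ?case .
qed

lemma norm_sqrt_iter_diff:
  assumes lin: "linear Y" and Y: "\<And>x. norm (Y x) \<le> norm x"
  shows "norm (sqrt_iter Y (n + k) x - sqrt_iter Y n x)
    \<le> (sqrt_majorant (n + k) - sqrt_majorant n) * norm x"
proof (induction k)
  case (Suc k)
  have "norm (sqrt_iter Y (Suc (n + k)) x - sqrt_iter Y n x) \<le>
     norm (sqrt_iter Y (Suc (n + k)) x - sqrt_iter Y (n + k) x)
     + norm (sqrt_iter Y (n + k) x - sqrt_iter Y n x)"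
    using norm_triangle_ineq[of "sqrt_iter Y (Suc (n + k)) x - sqrt_iter Y (n + k) x"
        "sqrt_iter Y (n + k) x - sqrt_iter Y n x"] by (simp only: diff_add_cancel add_diff_eq)
  also have "\<dots> \<le> (sqrt_majorant (Suc (n + k)) - sqrt_majorant (n + k)) * norm x
      + (sqrt_majorant (n + k) - sqrt_majorant n) * norm x"
    by (intro add_mono norm_sqrt_iter_diff_Suc[OF lin Y] Suc)
  finally show ?case by (simp only: add_Suc_right algebra_simps)
qed simp

text \<open>The pointwise limit of the iteration. The fourth property is
  \<open>(1 - X)^2 = 1 - Y\<close> expanded.\<close>

lemma contraction_sqrt_exists:
  fixes Y :: "'a::{real_inner, complete_space} \<Rightarrow> 'a"
  assumes lin: "linear Y" and sym: "\<And>x y. inner (Y x) y = inner x (Y y)"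
    and Y: "\<And>x. norm (Y x) \<le> norm x"
  obtains X where "linear X" "\<And>x y. inner (X x) y = inner x (X y)" "\<And>x. norm (X x) \<le> norm x"
    "\<And>x. 2 *\<^sub>R X x = Y x + X (X x)"
    "\<forall>P. bounded_linear P \<longrightarrow> (\<forall>x. P (Y x) = Y (P x)) \<longrightarrow> (\<forall>x. P (X x) = X (P x))"
proof -
  let ?X = "sqrt_iter Y"
  have "incseq sqrt_majorant" by (rule incseq_SucI) (rule sqrt_majorant_mono)
  then obtain q where "sqrt_majorant \<longlonglongrightarrow> q"
    using incseq_convergent[of sqrt_majorant 1] sqrt_majorant_bounds(2) by blast
  then have cq: "Cauchy sqrt_majorant" by (rule LIMSEQ_imp_Cauchy)
  have "Cauchy (\<lambda>n. ?X n x)" for x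
  proof (rule CauchyI')
    fix e :: real assume e: "e > 0"
    \<comment> \<open>Adding 1 keeps the divisor positive when \<open>x = 0\<close>.\<close>
    define c where "c = norm x + 1"
    have c: "c > 0" unfolding c_def by (simp add: add_nonneg_pos)
    obtain M where M: "\<And>m n. m \<ge> M \<Longrightarrow> n \<ge> M \<Longrightarrow> dist (sqrt_majorant m) (sqrt_majorant n) < e / c"
      using metric_CauchyD[OF cq, of "e / c"] e c by auto
    have "dist (?X m x) (?X n x) < e" if "m \<ge> M" "n > m" for m n
    proof -
      have n: "n = m + (n - m)" using that by simp
      have "dist (?X m x) (?X n x) = norm (?X (m + (n - m)) x - ?X m x)"
        using n by (simp add: dist_norm norm_minus_commute)
      also have "\<dots> \<le> (sqrt_majorant (m + (n - m)) - sqrt_majorant m) * norm x"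
        by (rule norm_sqrt_iter_diff[OF lin Y])
      also have "\<dots> = (sqrt_majorant n - sqrt_majorant m) * norm x" using n by simp
      also have "\<dots> \<le> (e / c) * norm x"
        using M[of n m] that by (intro mult_right_mono) (auto simp: dist_real_def)
      also have "\<dots> < (e / c) * c" using e c by (intro mult_strict_left_mono) (auto simp: c_def)
      also have "\<dots> = e" using c by simp
      finally show ?thesis .
    qed
    then show "\<exists>M. \<forall>m\<ge>M. \<forall>n>m. dist (?X m x) (?X n x) < e" by blast
  qed
  then have "\<exists>l. (\<lambda>n. ?X n x) \<longlonglongrightarrow> l" for x using Cauchy_convergent convergent_def by blast
  then obtain X where X: "\<And>x. (\<lambda>n. ?X n x) \<longlonglongrightarrow> X x" by metis
  have nX: "norm (?X n x) \<le> norm x" for n x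
    using norm_sqrt_iter_le[OF Y, of n x] sqrt_majorant_bounds(2)[of n]
      mult_right_mono[of "sqrt_majorant n" 1 "norm x"] by simp
  have lX: "linear X"
  proof (rule linearI)
    show "X (x + y) = X x + X y" for x y
      using LIMSEQ_unique[OF X[of "x + y"]] tendsto_add[OF X[of x] X[of y]]
      by (simp add: linear_add[OF linear_sqrt_iter[OF lin]])
    show "X (c *\<^sub>R x) = c *\<^sub>R X x" for c x
      using LIMSEQ_unique[OF X[of "c *\<^sub>R x"]] tendsto_scaleR[OF tendsto_const X[of x], of c]
      by (simp add: linear_scale[OF linear_sqrt_iter[OF lin]])
  qed
  moreover have "inner (X x) y = inner x (X y)" for x y
  proof (rule LIMSEQ_unique)
    show "(\<lambda>n. inner (?X n x) y) \<longlonglongrightarrow> inner (X x) y" by (intro tendsto_intros X)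
    show "(\<lambda>n. inner (?X n x) y) \<longlonglongrightarrow> inner x (X y)"
      unfolding sqrt_iter_symmetric[OF sym] by (intro tendsto_intros X)
  qed
  moreover have "norm (X x) \<le> norm x" for x
    by (rule LIMSEQ_le_const2[OF tendsto_norm[OF X]]) (use nX in blast)
  moreover have "2 *\<^sub>R X x = Y x + X (X x)" for x
  proof -
    \<comment> \<open>The iterates are uniformly contractive, so replacing the inner iterate by its
      limit costs only a null sequence.\<close>
    have "(\<lambda>n. ?X n (?X n x - X x)) \<longlonglongrightarrow> 0"
    proof (rule tendsto_norm_zero_cancel, rule tendsto_sandwich[OF _ _ tendsto_const])
      show "(\<lambda>n. norm (?X n x - X x)) \<longlonglongrightarrow> 0"
        using X LIM_zero tendsto_norm_zero by blast
    qed (use nX in auto)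
    from tendsto_add[OF this X[of "X x"]]
    have "(\<lambda>n. ?X n (?X n x)) \<longlonglongrightarrow> X (X x)"
      by (simp add: linear_diff[OF linear_sqrt_iter[OF lin]])
    then have "(\<lambda>n. 2 *\<^sub>R ?X (Suc n) x) \<longlonglongrightarrow> Y x + X (X x)"
      by (simp add: tendsto_add)
    moreover have "(\<lambda>n. 2 *\<^sub>R ?X (Suc n) x) \<longlonglongrightarrow> 2 *\<^sub>R X x"
      by (intro tendsto_intros LIMSEQ_Suc X)
    ultimately show ?thesis using LIMSEQ_unique by blast
  qed
  moreover have "P (X x) = X (P x)" if P: "bounded_linear P" "\<And>x. P (Y x) = Y (P x)" for P x
  proof (rule LIMSEQ_unique)
    show "(\<lambda>n. P (?X n x)) \<longlonglongrightarrow> P (X x)" by (rule bounded_linear.tendsto[OF P(1) X])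
    show "(\<lambda>n. P (?X n x)) \<longlonglongrightarrow> X (P x)"
      using X sqrt_iter_commute[of P Y, OF bounded_linear.linear[OF P(1)] P(2)] by simp
  qed
  ultimately show thesis using that by blast
qed

text \<open>Rescaling: \<open>Y = 1 - R / c\<close> has its form between 0 and that of the identity,
  hence is a contraction, and \<open>Q = sqrt c (1 - X)\<close> squares to
  \<open>c (1 - Y) = R\<close>.\<close>

lemma psd_sqrt_exists:
  fixes R :: "'a::{real_inner, complete_space} \<Rightarrow> 'a"
  assumes lin: "linear R" and sym: "\<And>x y. inner (R x) y = inner x (R y)"
    and pos: "\<And>x. 0 \<le> inner x (R x)" and bd: "\<And>x. inner x (R x) \<le> c * (norm x)\<^sup>2" and c: "c > 0"
  obtains Q where "bounded_linear Q" "\<And>x y. inner (Q x) y = inner x (Q y)"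
    "\<And>x. 0 \<le> inner x (Q x)" "\<And>x. Q (Q x) = R x"
    "\<forall>P. bounded_linear P \<longrightarrow> (\<forall>x. P (R x) = R (P x)) \<longrightarrow> (\<forall>x. P (Q x) = Q (P x))"
proof -
  define Y where "Y x = x - (1 / c) *\<^sub>R R x" for x
  have linY: "linear Y"
    unfolding Y_def
    by (rule linearI) (simp_all add: linear_add[OF lin] linear_scale[OF lin] algebra_simps)
  have symY: "inner (Y x) y = inner x (Y y)" for x y
    by (simp add: Y_def inner_diff_left inner_diff_right sym)
  have posY: "0 \<le> inner x (Y x)" and bdY: "inner x (Y x) \<le> 1 * (norm x)\<^sup>2" for x
    using bd[of x] pos[of x] c
    by (simp_all add: Y_def inner_diff_right power2_norm_eq_inner field_simps)
  have "norm (Y x) \<le> norm x" for x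
  proof -
    have "(norm (Y x))\<^sup>2 \<le> (norm x)\<^sup>2"
      using psd_norm_bound[OF linY symY posY bdY, of x] bdY[of x] by linarith
    then show ?thesis by simp
  qed
  then obtain X where X: "linear X" "\<And>x y. inner (X x) y = inner x (X y)"
    "\<And>x. norm (X x) \<le> norm x" "\<And>x. 2 *\<^sub>R X x = Y x + X (X x)"
    "\<forall>P. bounded_linear P \<longrightarrow> (\<forall>x. P (Y x) = Y (P x)) \<longrightarrow> (\<forall>x. P (X x) = X (P x))"
    using contraction_sqrt_exists[OF linY symY] by blast
  define Q where "Q x = sqrt c *\<^sub>R (x - X x)" for x
  have "bounded_linear X"
    by (rule bounded_linear_intro[of X 1]) (use X(3) linear_add[OF X(1)] linear_scale[OF X(1)] in auto)
  then have bQ: "bounded_linear Q"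
    unfolding Q_def by (intro bounded_linear_intros)
  have "inner (Q x) y = inner x (Q y)" for x y
    by (simp add: Q_def inner_diff_left inner_diff_right X(2))
  moreover have "0 \<le> inner x (Q x)" for x
  proof -
    have "inner x (X x) \<le> norm x * norm x"
      by (rule order_trans[OF norm_cauchy_schwarz mult_left_mono[OF X(3)]]) simp
    then show ?thesis using c by (simp add: Q_def inner_diff_right flip: power2_norm_eq_inner)
        (simp add: power2_eq_square)
  qed
  moreover have "Q (Q x) = R x" for x
  proof -
    have "Q (Q x) = c *\<^sub>R ((x - X x) - X (x - X x))"
      using c by (simp add: Q_def linear_scale[OF X(1)] flip: scaleR_diff_right)
    also have "\<dots> = c *\<^sub>R (x - 2 *\<^sub>R X x + X (X x))"
      by (simp add: linear_diff[OF X(1)] scaleR_2 algebra_simps)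
    also have "\<dots> = R x" unfolding X(4) using c by (simp add: Y_def)
    finally show ?thesis .
  qed
  moreover have "P (Q x) = Q (P x)" if P: "bounded_linear P" "\<And>x. P (R x) = R (P x)" for P x
  proof -
    note l = bounded_linear.linear[OF P(1)]
    have "P (Y x) = Y (P x)" for x
      by (simp add: Y_def linear_diff[OF l] linear_scale[OF l] P(2))
    then have "P (X x) = X (P x)" using X(5) P(1) by blast
    then show ?thesis by (simp add: Q_def linear_diff[OF l] linear_scale[OF l])
  qed
  ultimately show thesis using that bQ by blast
qed

text \<open>Commutation gives \<open>(P + Q)(P - Q) = 0\<close>, so both nonnegative forms vanish at
  \<open>z = P y - Q y\<close>. Cauchy-Schwarz then yields \<open>P z = 0\<close>, and injectivity
  \<open>z = 0\<close>.\<close>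

lemma psd_sqrt_unique:
  fixes P Q :: "'a::real_inner \<Rightarrow> 'a"
  assumes P: "linear P" "\<And>x y. inner (P x) y = inner x (P y)" "\<And>x. 0 \<le> inner x (P x)"
    and Q: "linear Q" "\<And>x. 0 \<le> inner x (Q x)"
    and eq: "\<And>x. P (P x) = Q (Q x)" and comm: "\<And>x. P (Q x) = Q (P x)" and inj: "inj P"
  shows "P = Q"
proof
  fix y
  define z where "z = P y - Q y"
  have "P z + Q z = 0"
    by (simp add: z_def linear_diff[OF P(1)] linear_diff[OF Q(1)] eq comm)
  then have "inner z (P z) + inner z (Q z) = 0" by (simp flip: inner_add_right)
  then have "inner z (P z) = 0" using P(3)[of z] Q(2)[of z] by linarith
  then have "(inner (P z) (P z))\<^sup>2 \<le> 0"
    using psd_Cauchy_Schwarz[OF P, of "P z" z] by simp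
  then have "P z = P 0" using linear_0[OF P(1)] by simp
  then have "z = 0" using inj by (auto dest: injD)
  then show "P y = Q y" by (simp add: z_def)
qed

section \<open>Existence and uniqueness of the square root of a semibounded operator\<close>

definition is_op_sqrt :: "'a::real_inner set \<Rightarrow> ('a \<Rightarrow> 'a) \<Rightarrow> real \<Rightarrow> 'a set \<Rightarrow> ('a \<Rightarrow> 'a) \<Rightarrow> bool" where
  "is_op_sqrt D T a E S \<longleftrightarrow>
      selfadjoint_op E S \<and> (\<forall>x\<in>E. 0 \<le> inner x (S x)) \<and> (\<forall>x. x \<notin> E \<longrightarrow> S x = 0)
      \<and> D = {x \<in> E. S x \<in> E} \<and> (\<forall>x\<in>D. S (S x) = T x - a *\<^sub>R x)"

text \<open>
  \<open>S\<close> plays the role of \<open>(T - a)\<^sup>1\<^sup>/\<^sup>2\<close>, with domain \<open>range Q\<close>, and \<open>Q\<close> that of its inverse.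
\<close>

locale inverse_root =
  fixes Q S :: "'a::{real_inner, complete_space} \<Rightarrow> 'a"
  assumes bounded_linear_Q: "bounded_linear Q"
    and symmetric_Q: "inner (Q x) y = inner x (Q y)"
    and dense_range_Q: "closure (range Q) = UNIV"
    and S_Q [simp]: "S (Q y) = y"

text \<open>The root is built from the bounded side: \<open>Q\<close> is the positive root of
  \<open>R = (T - a)^(-1)\<close>, and \<open>S\<close> inverts \<open>Q\<close> on its range. Any
  competing root has a bounded positive inverse that also squares to \<open>R\<close>, hence equals
  \<open>Q\<close>. So the definite description in \<open>op_sqrt\<close> denotes this pair.\<close>

lemma op_sqrt_inverse_root:
  fixes T :: "'a::{real_inner, complete_space} \<Rightarrow> 'a"
  assumes T: "selfadjoint_op D T" and ca: "c > a"
    and lb: "\<And>x. x \<in> D \<Longrightarrow> c * (norm x)\<^sup>2 \<le> inner x (T x)"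
  obtains Q where "inverse_root Q (sqrt_map D T a)" "sqrt_dom D T a = range Q"
    "inv_sqrt_map D T a = Q"
proof -
  note Ta = selfadjoint_shift[OF T, of a]
  define d where "d = c - a"
  have d: "d > 0" using ca by (simp add: d_def)
  have co: "d * (norm x)\<^sup>2 \<le> inner x (T x - a *\<^sub>R x)" if "x \<in> D" for x
    using lb[OF that] by (simp add: d_def inner_diff_right power2_norm_eq_inner algebra_simps)
  have bij: "bij_betw (\<lambda>x. T x - a *\<^sub>R x) D UNIV"
    and nb: "\<And>x. x \<in> D \<Longrightarrow> d * norm x \<le> norm (T x - a *\<^sub>R x)"
    using selfadjoint_coercive_bij[OF Ta d] co by blast+
  obtain R where R: "linear R" "\<And>x y. inner (R x) y = inner x (R y)" "\<And>y. R y \<in> D"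
    "\<And>y. T (R y) - a *\<^sub>R R y = y" "\<And>x. x \<in> D \<Longrightarrow> R (T x - a *\<^sub>R x) = x"
    using selfadjoint_inverse[OF Ta bij] by metis
  have Rpos: "0 \<le> inner y (R y)" for y
  proof -
    have "0 \<le> d * (norm (R y))\<^sup>2" using d by simp
    then show ?thesis using co[OF R(3)[of y]] R(4)[of y] by (simp add: inner_commute)
  qed
  have Rbd: "inner y (R y) \<le> (1 / d) * (norm y)\<^sup>2" for y
  proof -
    have "norm (R y) \<le> (1 / d) * norm y" using nb[OF R(3)[of y]] R(4)[of y] d by (simp add: field_simps)
    then have "norm y * norm (R y) \<le> norm y * ((1 / d) * norm y)" by (intro mult_left_mono) auto
    then show ?thesis using norm_cauchy_schwarz[of y "R y"] by (simp add: power2_eq_square)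
  qed
  have "1 / d > 0" using d by simp
  obtain Q where Q: "bounded_linear Q" "\<And>x y. inner (Q x) y = inner x (Q y)"
    "\<And>x. 0 \<le> inner x (Q x)" "\<And>x. Q (Q x) = R x"
    "\<forall>P. bounded_linear P \<longrightarrow> (\<forall>x. P (R x) = R (P x)) \<longrightarrow> (\<forall>x. P (Q x) = Q (P x))"
    using psd_sqrt_exists[OF R(1,2) Rpos Rbd \<open>1 / d > 0\<close>] by blast
  note lQ = bounded_linear.linear[OF Q(1)]
  have DR: "D = range R"
  proof (intro equalityI subsetI)
    show "x \<in> range R" if "x \<in> D" for x using R(5)[OF that] by (metis rangeI)
  qed (use R(3) in blast)
  have injR: "inj R" using R(4) by (metis injI)
  have injQ: "inj Q" using injR Q(4) by (metis injD injI)
  define E where "E = range Q"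
  define S where "S x = (if x \<in> E then inv Q x else 0)" for x
  have SQ: "S (Q y) = y" for y using injQ by (simp add: S_def E_def)
  have dense: "closure E = UNIV"
  proof -
    have "D \<subseteq> E" unfolding DR E_def using Q(4) by (metis image_subsetI rangeI)
    then show ?thesis using selfadjointD(2)[OF T] closure_mono by blast
  qed
  have "selfadjoint_op E S"
    unfolding selfadjoint_op_def op_linear_def
  proof (intro conjI ballI allI impI dense)
    show "subspace E" unfolding E_def by (rule linear_subspace_image[OF lQ]) simp
  next
    fix x y assume "x \<in> E" "y \<in> E"
    then obtain u v where [simp]: "x = Q u" "y = Q v" by (auto simp: E_def)
    show "S (x + y) = S x + S y" by (simp add: SQ flip: linear_add[OF lQ])
    show "inner (S x) y = inner x (S y)" by (simp add: SQ Q(2))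
  next
    fix k x assume "x \<in> E"
    then obtain u where [simp]: "x = Q u" by (auto simp: E_def)
    show "S (k *\<^sub>R x) = k *\<^sub>R S x" by (simp add: SQ flip: linear_scale[OF lQ])
  next
    fix y z assume "\<forall>x\<in>E. inner y (S x) = inner z x"
    \<comment> \<open>Substituting \<open>x = Q u\<close> turns the adjoint relation into one tested
      on all vectors \<open>u\<close>.\<close>
    then have "inner y u = inner (Q z) u" for u by (simp add: E_def SQ Q(2))
    then have "y = Q z" by (rule eq_if_inner_eq_on_dense[OF closure_UNIV])
    then show "y \<in> E" by (simp add: E_def)
  qed
  moreover have "\<forall>x\<in>E. 0 \<le> inner x (S x)"
    using Q(3) by (auto simp: E_def SQ inner_commute)
  moreover have "D = {x \<in> E. S x \<in> E}"
    unfolding DR by (auto simp: E_def SQ simp flip: Q(4))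
  moreover have "\<forall>x\<in>D. S (S x) = T x - a *\<^sub>R x"
    using R(4) by (auto simp: DR SQ simp flip: Q(4))
  ultimately have ex: "is_op_sqrt D T a E S"
    unfolding is_op_sqrt_def by (simp add: S_def)
  have uniq: "E' = E \<and> S' = S" if "is_op_sqrt D T a E' S'" for E' S'
  proof -
    have sa: "selfadjoint_op E' S'" and pos: "\<And>x. x \<in> E' \<Longrightarrow> 0 \<le> inner x (S' x)"
      and out: "\<And>x. x \<notin> E' \<Longrightarrow> S' x = 0" and D: "D = {x \<in> E'. S' x \<in> E'}"
      and SS: "\<And>x. x \<in> D \<Longrightarrow> S' (S' x) = T x - a *\<^sub>R x"
      using that unfolding is_op_sqrt_def by blast+
    note sub = selfadjointD(1)[OF sa]
    have sdiff: "S' (x - y) = S' x - S' y" if "x \<in> E'" "y \<in> E'" for x y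
      using selfadjointD(3)[OF sa, of x "(-1) *\<^sub>R y"] selfadjointD(4)[OF sa, of y "-1"] that
        subspace_scale[OF sub, of y "-1"] by simp
    \<comment> \<open>If \<open>S'\<close> agrees at two points, their difference lies in
      \<open>D\<close> and is annihilated by \<open>S'^2 = T - a\<close>, which is
      injective.\<close>
    have inj: "x = y" if "x \<in> E'" "y \<in> E'" "S' x = S' y" for x y
    proof -
      have 0: "0 \<in> E'" "S' 0 = 0" using subspace_0[OF sub] sdiff[of 0 0] by simp_all
      have xy: "x - y \<in> E'" "S' (x - y) = 0" using that sdiff sub by (simp_all add: subspace_diff)
      then have "x - y \<in> D" using 0 D by simp
      moreover from SS[OF this] have "T (x - y) - a *\<^sub>R (x - y) = 0" using xy 0 by simp
      ultimately have "x - y = R 0" using R(5) by metis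
      then show ?thesis using linear_0[OF R(1)] by simp
    qed
    \<comment> \<open>\<open>S' (S'\<^sup>2)\<^sup>-\<^sup>1\<close> is the inverse of \<open>S'\<close>; this form makes it total and linear at once.\<close>
    define P where "P y = S' (R y)" for y
    have RE: "R y \<in> E'" for y using R(3) D by blast
    have P1: "P y \<in> E'" for y using R(3) D by (auto simp: P_def)
    have SP: "S' (P y) = y" for y using SS R(3,4) by (simp add: P_def)
    have PS: "P (S' x) = x" if "x \<in> E'" for x using inj[OF P1 that] SP by simp
    have linP: "linear P"
      by (rule linearI) (simp_all add: P_def linear_add[OF R(1)] linear_scale[OF R(1)]
          selfadjointD(3)[OF sa RE RE] selfadjointD(4)[OF sa RE])
    have symP: "inner (P x) y = inner x (P y)" for x y
      using selfadjointD(5)[OF sa P1 P1, of x y] by (simp add: SP)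
    have posP: "0 \<le> inner x (P x)" for x using pos[OF P1, of x] by (simp add: SP inner_commute)
    have PP: "P (P x) = R x" for x
      by (rule inj[OF P1 RE]) (simp add: SP P_def[symmetric])
    \<comment> \<open>Boundedness of \<open>P\<close> follows from \<open>P^2 = R\<close> and admits
      \<open>P\<close> to the commutation property of \<open>Q\<close>: it commutes with
      \<open>R\<close> as \<open>R\<close> is its square, hence with \<open>Q\<close>.\<close>
    have "norm (P y) \<le> norm y * sqrt (1 / d)" for y
    proof -
      have "(norm (P y))\<^sup>2 = inner y (R y)" by (simp add: power2_norm_eq_inner symP PP)
      also have "\<dots> \<le> (1 / d) * (norm y)\<^sup>2" by (rule Rbd)
      finally have "sqrt ((norm (P y))\<^sup>2) \<le> sqrt ((1 / d) * (norm y)\<^sup>2)" by (rule real_sqrt_le_mono)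
      then show ?thesis by (simp only: real_sqrt_mult real_sqrt_abs abs_norm_cancel mult.commute)
    qed
    then have bP: "bounded_linear P"
      by (intro bounded_linear_intro linear_add[OF linP] linear_scale[OF linP])
    have "P = Q"
    proof (rule psd_sqrt_unique[OF linP symP posP lQ Q(3)])
      show "P (P x) = Q (Q x)" for x by (simp add: PP Q(4))
      show "P (Q x) = Q (P x)" for x using Q(5) bP by (simp flip: PP)
      show "inj P" using SP by (metis injI)
    qed
    have "E' = range P"
    proof (intro equalityI subsetI)
      show "x \<in> range P" if "x \<in> E'" for x using PS[OF that] by (metis rangeI)
    qed (use P1 in blast)
    then have "E' = E" using \<open>P = Q\<close> by (simp add: E_def)
    moreover have "S' x = S x" for x
    proof (cases "x \<in> E'")
      case True
      then have "Q (S' x) = x" using PS \<open>P = Q\<close> by simp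
      then have "S x = S (Q (S' x))" by (simp only:)
      then show ?thesis by (simp only: SQ)
    next
      case False
      then show ?thesis using out \<open>E' = E\<close> by (simp add: S_def)
    qed
    ultimately show ?thesis by blast
  qed
  have "op_sqrt D T a = (THE ES. case ES of (E, S) \<Rightarrow> is_op_sqrt D T a E S)"
    by (simp only: op_sqrt_def is_op_sqrt_def)
  also have "\<dots> = (E, S)"
  proof (rule the_equality)
    fix ES assume "case ES of (E, S) \<Rightarrow> is_op_sqrt D T a E S"
    then show "ES = (E, S)" using uniq[of "fst ES" "snd ES"] by (cases ES) simp
  qed (simp add: ex)
  finally have SE: "sqrt_map D T a = S" "sqrt_dom D T a = E" by (simp_all add: sqrt_map_def sqrt_dom_def)
  show thesis
  proof
    show "inverse_root Q (sqrt_map D T a)"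
      by (intro inverse_root.intro Q(1,2)) (use dense SQ in \<open>auto simp: E_def SE\<close>)
    show "sqrt_dom D T a = range Q" by (simp add: SE E_def)
    show "inv_sqrt_map D T a = Q"
    proof
      fix y
      have "inj_on S E" by (auto simp: inj_on_def E_def SQ)
      then have "inv_into E S (S (Q y)) = Q y" by (rule inv_into_f_f) (simp add: E_def)
      then show "inv_sqrt_map D T a y = Q y" by (simp add: inv_sqrt_map_def SE SQ)
    qed
  qed
qed

section \<open>Weak convergence, compact operators and compressions\<close>

context inverse_root
begin

lemma linear_Q: "linear Q"
  using bounded_linear_Q by (rule bounded_linear.linear)

lemma Q_S: "x \<in> range Q \<Longrightarrow> Q (S x) = x"
  by auto

lemma S_add: "x \<in> range Q \<Longrightarrow> y \<in> range Q \<Longrightarrow> S (x + y) = S x + S y"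
  by (auto simp flip: linear_add[OF linear_Q])

lemma S_diff: "x \<in> range Q \<Longrightarrow> y \<in> range Q \<Longrightarrow> S (x - y) = S x - S y"
  by (auto simp flip: linear_diff[OF linear_Q])

lemma S_scale: "x \<in> range Q \<Longrightarrow> S (c *\<^sub>R x) = c *\<^sub>R S x"
  by (auto simp flip: linear_scale[OF linear_Q])

lemma S_symmetric: "x \<in> range Q \<Longrightarrow> y \<in> range Q \<Longrightarrow> inner (S x) y = inner x (S y)"
  by (auto simp: symmetric_Q)

end

section \<open>Weakly null sequences and compact operators\<close>

lemma weakly_null_if_on_dense:
  fixes u :: "nat \<Rightarrow> 'a::real_inner"
  assumes D: "closure D = UNIV" and bd: "\<And>k. norm (u k) \<le> M"
    and wk: "\<And>y. y \<in> D \<Longrightarrow> (\<lambda>k. inner (u k) y) \<longlonglongrightarrow> 0"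
  shows "(\<lambda>k. inner (u k) y) \<longlonglongrightarrow> 0"
proof (rule LIMSEQ_I)
  fix e :: real assume e: "e > 0"
  have M: "M \<ge> 0" using bd[of 0] norm_ge_zero order_trans by blast
  have "y \<in> closure D" using D by simp
  then obtain d where d: "d \<in> D" "dist d y < e / (2 * (M + 1))"
    using e M unfolding closure_approachable by (meson add_nonneg_pos divide_pos_pos mult_pos_pos zero_less_numeral zero_less_one)
  obtain N where N: "\<And>k. k \<ge> N \<Longrightarrow> norm (inner (u k) d) < e / 2"
    using LIMSEQ_D[OF wk[OF d(1)], of "e / 2"] e by auto
  have "norm (inner (u k) y - 0) < e" if "k \<ge> N" for k
  proof -
    have "\<bar>inner (u k) (y - d)\<bar> \<le> norm (u k) * norm (y - d)" by (rule Cauchy_Schwarz_ineq2)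
    also have "\<dots> \<le> (M + 1) * (e / (2 * (M + 1)))"
      using bd[of k] d(2) M by (intro mult_mono) (auto simp: dist_norm norm_minus_commute)
    also have "\<dots> = e / 2" using M by (simp add: field_simps)
    finally have "\<bar>inner (u k) (y - d)\<bar> \<le> e / 2" .
    moreover have "inner (u k) y = inner (u k) (y - d) + inner (u k) d"
      by (simp add: inner_diff_right)
    ultimately show ?thesis using N[OF that] unfolding real_norm_def by linarith
  qed
  then show "\<exists>N. \<forall>k\<ge>N. norm (inner (u k) y - 0) < e" by blast
qed

text \<open>The test vectors \<open>c k\<close> vary with \<open>k\<close>, so pointwise convergence
  does not suffice. A finite net of the compact set reduces the claim to finitely many fixed test
  vectors.\<close>

lemma weakly_null_uniform_on_compact:
  fixes u c :: "nat \<Rightarrow> 'a::real_inner"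
  assumes C: "compact C" and bd: "\<And>k. norm (u k) \<le> M"
    and wk: "\<And>y. (\<lambda>k. inner (u k) y) \<longlonglongrightarrow> 0" and c: "\<And>k. c k \<in> C"
  shows "(\<lambda>k. inner (c k) (u k)) \<longlonglongrightarrow> 0"
proof (rule LIMSEQ_I)
  fix e :: real assume e: "e > 0"
  have M: "M \<ge> 0" using bd[of 0] norm_ge_zero order_trans by blast
  define d where "d = e / (2 * (M + 1))"
  have d: "d > 0" unfolding d_def using e M by simp
  obtain F where F: "finite F" "C \<subseteq> (\<Union>f\<in>F. ball f d)"
    using C d unfolding compact_eq_totally_bounded by blast
  have "\<forall>\<^sub>F k in sequentially. \<forall>f\<in>F. norm (inner (u k) f) < e / 2"
  proof (rule eventually_ball_finite[OF F(1)], rule ballI)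
    fix f
    have "\<exists>N. \<forall>k\<ge>N. norm (inner (u k) f) < e / 2" using LIMSEQ_D[OF wk[of f], of "e / 2"] e by auto
    then show "\<forall>\<^sub>F k in sequentially. norm (inner (u k) f) < e / 2"
      by (simp add: eventually_sequentially)
  qed
  then obtain N where N: "\<And>k f. k \<ge> N \<Longrightarrow> f \<in> F \<Longrightarrow> norm (inner (u k) f) < e / 2"
    unfolding eventually_sequentially by blast
  have "norm (inner (c k) (u k) - 0) < e" if "k \<ge> N" for k
  proof -
    obtain f where f: "f \<in> F" "dist f (c k) < d" using F(2) c[of k] by auto
    have "\<bar>inner (u k) (c k - f)\<bar> \<le> norm (u k) * norm (c k - f)" by (rule Cauchy_Schwarz_ineq2)
    also have "\<dots> \<le> (M + 1) * d"
      using bd[of k] f(2) M by (intro mult_mono) (auto simp: dist_norm norm_minus_commute)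
    also have "\<dots> = e / 2" using M by (simp add: d_def field_simps)
    finally have "\<bar>inner (u k) (c k - f)\<bar> \<le> e / 2" .
    moreover have "inner (c k) (u k) = inner (u k) (c k - f) + inner (u k) f"
      by (simp add: inner_diff_right inner_commute)
    ultimately show ?thesis using N[OF that f(1)] unfolding real_norm_def by linarith
  qed
  then show "\<exists>N. \<forall>k\<ge>N. norm (inner (c k) (u k) - 0) < e" by blast
qed

lemma compact_operator_bounded:
  assumes K: "compact_operator K"
  obtains M where "M > 0" "\<And>x. norm (K x) \<le> M * norm x"
proof -
  have lin: "linear K" and "compact (closure (K ` cball 0 1))"
    using K unfolding compact_operator_def by blast+
  then have "bounded (K ` cball 0 1)"
    using compact_imp_bounded bounded_subset closure_subset by blast
  then obtain M where M: "M > 0" "\<And>x. norm x \<le> 1 \<Longrightarrow> norm (K x) \<le> M"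
    unfolding bounded_pos by auto
  have "norm (K x) \<le> M * norm x" for x
  proof -
    have "K x = norm x *\<^sub>R K (sgn x)"
      by (cases "x = 0") (simp_all add: sgn_div_norm linear_0[OF lin] linear_scale[OF lin])
    moreover have "norm (K (sgn x)) \<le> M" by (rule M(2)) (simp add: norm_sgn)
    ultimately show ?thesis
      using mult_left_mono[of "norm (K (sgn x))" M "norm x"] by (simp add: mult.commute)
  qed
  with M(1) show thesis using that by blast
qed

text \<open>After scaling, the images lie in a compact set; pairing them with themselves in the
  uniform statement gives norm convergence. Weak nullity is asked of the images, and only on a dense
  set, so that no adjoint of \<open>K\<close> has to be constructed.\<close>

lemma compact_operator_weakly_null:
  fixes K :: "'a::real_inner \<Rightarrow> 'a"
  assumes K: "compact_operator K" and bd: "\<And>k. norm (u k) \<le> M"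
    and D: "closure D = UNIV" and wk: "\<And>y. y \<in> D \<Longrightarrow> (\<lambda>k. inner (K (u k)) y) \<longlonglongrightarrow> 0"
  shows "(\<lambda>k. K (u k)) \<longlonglongrightarrow> 0"
proof -
  have lin: "linear K" and C: "compact (closure (K ` cball 0 1))"
    using K unfolding compact_operator_def by blast+
  obtain B where B: "B > 0" "\<And>x. norm (K x) \<le> B * norm x"
    using compact_operator_bounded[OF K] by blast
  have M: "M \<ge> 0" using bd[of 0] norm_ge_zero order_trans by blast
  define m where "m = M + 1"
  have m: "m > 0" using M by (simp add: m_def)
  define v where "v k = (1 / m) *\<^sub>R K (u k)" for k
  have vC: "v k \<in> closure (K ` cball 0 1)" for k
  proof -
    have "norm ((1 / m) *\<^sub>R u k) \<le> 1" using bd[of k] m by (simp add: m_def field_simps)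
    then have "K ((1 / m) *\<^sub>R u k) \<in> K ` cball 0 1" by (intro imageI) simp
    then have "v k \<in> K ` cball 0 1" by (simp only: v_def linear_scale[OF lin])
    then show ?thesis by (rule subsetD[OF closure_subset])
  qed
  have vb: "norm (v k) \<le> (1 / m) * (B * M)" for k
  proof -
    have "norm (K (u k)) \<le> B * M"
      using B(2)[of "u k"] mult_left_mono[OF bd[of k], of B] B(1) by linarith
    then have "(1 / m) * norm (K (u k)) \<le> (1 / m) * (B * M)"
      using m by (intro mult_left_mono) auto
    then show ?thesis using m by (simp add: v_def)
  qed
  have "(\<lambda>k. inner (v k) y) \<longlonglongrightarrow> 0" for y
  proof (rule weakly_null_if_on_dense[OF D vb])
    fix y assume "y \<in> D"
    from tendsto_mult_right_zero[OF wk[OF this], of "1 / m"]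
    show "(\<lambda>k. inner (v k) y) \<longlonglongrightarrow> 0" by (simp add: v_def)
  qed
  from weakly_null_uniform_on_compact[OF C vb this vC]
  have "(\<lambda>k. sqrt (inner (v k) (v k))) \<longlonglongrightarrow> sqrt 0" by (rule tendsto_real_sqrt)
  then have "(\<lambda>k. norm (v k)) \<longlonglongrightarrow> 0" by (simp flip: norm_eq_sqrt_inner)
  then have "v \<longlonglongrightarrow> 0" by (rule tendsto_norm_zero_cancel)
  from tendsto_scaleR[OF tendsto_const this, of m] show ?thesis using m by (simp add: v_def)
qed

text \<open>Normalising \<open>w k\<close> puts its image in a fixed compact set, whatever the size
  of \<open>w k\<close>; for \<open>w k = 0\<close> the convention \<open>sgn 0 = 0\<close> does no
  harm.\<close>

lemma compact_operator_form_weakly_null: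
  fixes K :: "'a::real_inner \<Rightarrow> 'a"
  assumes K: "compact_operator K" and bd: "\<And>k. norm (s k) \<le> M"
    and wk: "\<And>y. (\<lambda>k. inner (s k) y) \<longlonglongrightarrow> 0"
  obtains e where "e \<longlonglongrightarrow> 0" "\<And>k. inner (K (w k)) (s k) \<le> e k * norm (w k)"
proof -
  have lin: "linear K" and C: "compact (closure (K ` cball 0 1))"
    using K unfolding compact_operator_def by blast+
  define e where "e k = inner (K (sgn (w k))) (s k)" for k
  have "K (sgn (w k)) \<in> closure (K ` cball 0 1)" for k
    by (rule subsetD[OF closure_subset]) (simp add: norm_sgn)
  from weakly_null_uniform_on_compact[of _ s M "\<lambda>k. K (sgn (w k))", OF C bd wk this] have "e \<longlonglongrightarrow> 0" by (simp add: e_def[abs_def])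
  moreover have "inner (K (w k)) (s k) \<le> e k * norm (w k)" for k
  proof -
    have "K (w k) = norm (w k) *\<^sub>R K (sgn (w k))"
      by (cases "w k = 0") (simp_all add: sgn_div_norm linear_0[OF lin] linear_scale[OF lin])
    then show ?thesis by (simp add: e_def)
  qed
  ultimately show thesis using that by blast
qed

text \<open>Part of the Fredholm alternative. Otherwise there are unit vectors \<open>u\<close> with
  \<open>u + K u\<close> tending to 0; along a subsequence \<open>K u\<close> converges to some
  \<open>w\<close>, so \<open>u\<close> converges to \<open>- w\<close>, a unit vector in the kernel
  of \<open>I + K\<close>.\<close>

lemma id_plus_compact_bounded_below:
  fixes K :: "'a::real_normed_vector \<Rightarrow> 'a"
  assumes K: "compact_operator K" and inj: "\<And>x. x + K x = 0 \<Longrightarrow> x = 0"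
  obtains N where "N > 0" "\<And>x. norm x \<le> N * norm (x + K x)"
proof -
  have lin: "linear K" and C: "compact (closure (K ` cball 0 1))"
    using K unfolding compact_operator_def by blast+
  obtain B where B: "B > 0" "\<And>x. norm (K x) \<le> B * norm x"
    using compact_operator_bounded[OF K] by blast
  then have bl: "bounded_linear K"
    by (intro bounded_linear_intro[of K B] linear_add[OF lin] linear_scale[OF lin])
       (simp_all add: mult.commute)
  have "\<exists>N::nat. \<forall>x. norm x \<le> real (Suc N) * norm (x + K x)"
  proof (rule ccontr)
    assume "\<not> ?thesis"
    then obtain x where x: "\<And>N. norm (x N) > real (Suc N) * norm (x N + K (x N))"
      by (metis not_le)
    define u where "u N = sgn (x N)" for N
    have xn: "norm (x N) > 0" for N
      using x[of N] by (metis le_less_trans mult_nonneg_nonneg norm_ge_zero of_nat_0_le_iff)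
    have un: "norm (u N) = 1" for N using xn[of N] by (simp add: u_def norm_sgn)
    have small: "norm (u N + K (u N)) < 1 / real (Suc N)" for N
    proof -
      have "u N + K (u N) = (1 / norm (x N)) *\<^sub>R (x N + K (x N))"
        by (simp add: u_def sgn_div_norm linear_scale[OF lin] scaleR_add_right divide_inverse)
      then have "norm (u N + K (u N)) = norm (x N + K (x N)) / norm (x N)" by simp
      moreover have "real (Suc N) * (norm (x N + K (x N)) / norm (x N)) < 1"
        using x[of N] xn[of N] by (simp add: pos_divide_less_eq del: of_nat_Suc)
      ultimately show ?thesis by (simp add: pos_less_divide_eq mult.commute del: of_nat_Suc)
    qed
    have lim0: "(\<lambda>N. u N + K (u N)) \<longlonglongrightarrow> 0"
    proof (rule tendsto_norm_zero_cancel, rule tendsto_sandwich[OF _ _ tendsto_const])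
      show "(\<lambda>N. 1 / real (Suc N)) \<longlonglongrightarrow> 0"
        using LIMSEQ_inverse_real_of_nat by (simp add: inverse_eq_divide)
    qed (use small less_imp_le in \<open>auto intro!: always_eventually\<close>)
    have "K (u N) \<in> closure (K ` cball 0 1)" for N
      by (rule subsetD[OF closure_subset]) (simp add: un)
    then obtain w r where r: "strict_mono r" "((\<lambda>N. K (u N)) \<circ> r) \<longlonglongrightarrow> w"
      using C unfolding compact_def by metis
    have "(\<lambda>N. (u (r N) + K (u (r N))) - K (u (r N))) \<longlonglongrightarrow> 0 - w"
      using tendsto_diff[OF LIMSEQ_subseq_LIMSEQ[OF lim0 r(1)] r(2)] by (simp add: o_def)
    then have ur: "(\<lambda>N. u (r N)) \<longlonglongrightarrow> - w" by simp
    have "norm (- w) = 1" using LIMSEQ_unique[OF tendsto_norm[OF ur]] un by simp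
    moreover have "- w + K (- w) = 0"
    proof (rule LIMSEQ_unique)
      show "(\<lambda>N. u (r N) + K (u (r N))) \<longlonglongrightarrow> - w + K (- w)"
        by (intro tendsto_add ur bounded_linear.tendsto[OF bl])
      show "(\<lambda>N. u (r N) + K (u (r N))) \<longlonglongrightarrow> 0"
        using LIMSEQ_subseq_LIMSEQ[OF lim0 r(1)] by (simp add: o_def)
    qed
    ultimately show False using inj[of "- w"] by simp
  qed
  then show thesis using that by (metis of_nat_0_less_iff zero_less_Suc)
qed

lemma compact_operator_comp_bounded:
  fixes K H :: "'a::real_normed_vector \<Rightarrow> 'a"
  assumes K: "compact_operator K" and H: "bounded_linear H"
  shows "compact_operator (\<lambda>x. H (K x))"
proof -
  have lin: "linear K" and C: "compact (closure (K ` cball 0 1))"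
    using K unfolding compact_operator_def by blast+
  have HC: "compact (H ` closure (K ` cball 0 1))"
    by (rule compact_continuous_image[OF bounded_linear.continuous_on[OF H continuous_on_id] C])
  have "(\<lambda>x. H (K x)) ` cball 0 1 \<subseteq> H ` closure (K ` cball 0 1)"
    using closure_subset[of "K ` cball 0 1"] by auto
  then have "closure ((\<lambda>x. H (K x)) ` cball 0 1) \<subseteq> H ` closure (K ` cball 0 1)"
    using HC by (simp add: closure_minimal compact_imp_closed)
  then have "compact (closure ((\<lambda>x. H (K x)) ` cball 0 1))"
    using compact_Int_closed[OF HC closed_closure] by (metis inf.absorb_iff2)
  moreover have "linear (\<lambda>x. H (K x))"
    using linear_compose[OF lin bounded_linear.linear[OF H]] by (simp add: o_def)
  ultimately show ?thesis unfolding compact_operator_def by blast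
qed

section \<open>Riesz representation and compressions on finite-dimensional subspaces\<close>

lemma finite_dim_Riesz:
  fixes V :: "'a::real_inner set"
  assumes V: "finite_dim_subspace V"
    and add: "\<And>x y. x \<in> V \<Longrightarrow> y \<in> V \<Longrightarrow> f (x + y) = f x + f y"
    and scale: "\<And>c x. x \<in> V \<Longrightarrow> f (c *\<^sub>R x) = c * (f x :: real)"
  obtains z where "z \<in> V" "\<And>y. y \<in> V \<Longrightarrow> inner y z = f y"
proof -
  obtain B where "finite B" "span B = V" using V unfolding finite_dim_subspace_def by blast
  then obtain C where C: "finite C" "span C = V" "pairwise orthogonal C"
    using basis_orthogonal by metis
  have sub: "subspace V" using C(2) subspace_span by blast
  have CV: "C \<subseteq> V" using C(2) span_superset by blast
  \<comment> \<open>The expansion of the representing vector in an orthogonal spanning set. A zero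
    vector in \<open>C\<close> contributes nothing, as division by 0 gives 0.\<close>
  define z where "z = (\<Sum>c\<in>C. (f c / inner c c) *\<^sub>R c)"
  have zV: "z \<in> V" unfolding z_def using CV sub by (intro subspace_sum subspace_scale) auto
  have f0: "f 0 = 0" using scale[of 0 0] subspace_0[OF sub] by simp
  have base: "inner y z = f y" if y: "y \<in> C" for y
  proof -
    have "inner y z = (\<Sum>c\<in>C. if c = y then f y else 0)"
      unfolding z_def inner_sum_right
    proof (rule sum.cong)
      fix c assume c: "c \<in> C"
      show "inner y ((f c / inner c c) *\<^sub>R c) = (if c = y then f y else 0)"
        using C(3) c y f0 unfolding pairwise_def orthogonal_def by (cases "y = 0") auto
    qed simp
    then show ?thesis using y C(1) by simp
  qed
  have "y \<in> V \<and> inner y z = f y" if "y \<in> V" for y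
  proof -
    have "y \<in> span C" using that C(2) by simp
    then show ?thesis
    proof (rule span_induct[where P = "\<lambda>y. y \<in> V \<and> inner y z = f y"])
      show "subspace {y. y \<in> V \<and> inner y z = f y}"
        by (rule subspaceI)
           (auto simp: subspace_0[OF sub] f0 subspace_add[OF sub] add inner_add_left
             subspace_scale[OF sub] scale)
    qed (use CV base in blast)
  qed
  with zV show thesis using that by blast
qed

lemma compression_eqI:
  assumes L: "subspace (L n)" and "z \<in> L n"
    and "\<And>y. y \<in> L n \<Longrightarrow> inner y z = inner (sqrt_map D T a y) (sqrt_map D T a x) + a * inner y x"
  shows "compression D T a L n x = z"
  unfolding compression_def
proof (rule the_equality)
  fix w
  assume w: "w \<in> L n \<and> (\<forall>y\<in>L n. inner y w = inner (sqrt_map D T a y) (sqrt_map D T a x) + a * inner y x)"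
  then have "w - z \<in> L n" using assms subspace_diff by blast
  then have "inner (w - z) (w - z) = 0" using w assms(3) by (simp add: inner_diff_right)
  then show "w = z" by simp
qed (use assms in blast)

lemma finite_dim_subspace_imp_subspace: "finite_dim_subspace V \<Longrightarrow> subspace V"
  unfolding finite_dim_subspace_def using subspace_span by blast

text \<open>Riesz representation supplies the vector that the definite description in
  \<open>compression\<close> asks for.\<close>

lemma inner_compression:
  assumes "inverse_root Q (sqrt_map D T a)" and L: "finite_dim_subspace (L n)" "L n \<subseteq> range Q"
    and x: "x \<in> L n" and y: "y \<in> L n"
  shows "inner y (compression D T a L n x) = inner (sqrt_map D T a y) (sqrt_map D T a x) + a * inner y x"
proof -
  interpret inverse_root Q "sqrt_map D T a" by fact
  obtain z where z: "z \<in> L n"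
    "\<And>y. y \<in> L n \<Longrightarrow> inner y z = inner (sqrt_map D T a y) (sqrt_map D T a x) + a * inner y x"
    by (rule finite_dim_Riesz[OF L(1), of "\<lambda>y. inner (sqrt_map D T a y) (sqrt_map D T a x) + a * inner y x"])
       (use L(2) in \<open>auto simp: subset_iff S_add S_scale inner_add_left algebra_simps\<close>)
  have "compression D T a L n x = z"
    by (rule compression_eqI[of L n, OF finite_dim_subspace_imp_subspace[OF L(1)] z(1)]) (rule z(2))
  then show ?thesis using z(2)[OF y] by simp
qed

text \<open>\<open>S\<close> carries \<open>L\<close> onto a finite-dimensional space on which the
  form becomes the ordinary inner product; the vector found there is transported back by
  \<open>Q\<close>.\<close>

lemma (in inverse_root) form_Riesz:
  assumes L: "finite_dim_subspace L" "L \<subseteq> range Q"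
  obtains z where "z \<in> L" "\<And>y. y \<in> L \<Longrightarrow> inner (S y) (S z) = c * inner y x"
proof -
  obtain B where B: "finite B" "span B = L" using L(1) unfolding finite_dim_subspace_def by blast
  define V where "V = span (S ` B)"
  have "Q ` S ` B = B"
    unfolding image_image using Q_S span_superset[of B] B(2) L(2) by (simp add: subset_iff)
  then have QV: "Q ` V = L" unfolding V_def linear_span_image[OF linear_Q, symmetric] using B(2) by simp
  have "finite_dim_subspace V" unfolding finite_dim_subspace_def V_def using B(1) by blast
  then obtain v where v: "v \<in> V" "\<And>y. y \<in> V \<Longrightarrow> inner y v = c * inner (Q y) x"
    by (rule finite_dim_Riesz[of V "\<lambda>y. c * inner (Q y) x"])
       (auto simp: linear_add[OF linear_Q] linear_scale[OF linear_Q] inner_add_left algebra_simps)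
  show thesis
  proof (rule that)
    show "Q v \<in> L" using v(1) QV by blast
    fix y assume "y \<in> L"
    then obtain w where "w \<in> V" "y = Q w" using QV by blast
    then show "inner (S y) (S (Q v)) = c * inner y x" using v(2) by simp
  qed
qed

section \<open>Invariance of the limiting essential spectrum\<close>

text \<open>With \<open>K = SA Q - I\<close>, the identity \<open>SA x = (I + K) (SB x)\<close>
  reduces the bound to \<open>I + K\<close> being bounded below. Its kernel is trivial because
  \<open>SA Q\<close> is injective.\<close>

lemma inverse_root_pair_bounds:
  assumes "inverse_root P SA" "inverse_root Q SB" and ran: "range Q = range P"
    and K: "compact_operator (\<lambda>y. SA (Q y) - y)"
  obtains N where "N > 0" "\<And>x. x \<in> range P \<Longrightarrow> norm (SB x) \<le> N * norm (SA x)"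
proof -
  interpret A: inverse_root P SA by fact
  interpret B: inverse_root Q SB by fact
  have "y = 0" if "y + (SA (Q y) - y) = 0" for y
  proof -
    have "P (SA (Q y)) = Q y" using A.Q_S ran by blast
    then have "Q y = Q 0" using that by (simp add: linear_0[OF A.linear_Q] linear_0[OF B.linear_Q])
    then have "SB (Q y) = SB (Q 0)" by (rule arg_cong)
    then show ?thesis by simp
  qed
  from id_plus_compact_bounded_below[OF K this]
  obtain N where N: "N > 0" "\<And>y. norm y \<le> N * norm (y + (SA (Q y) - y))" by blast
  have "norm (SB x) \<le> N * norm (SA x)" if "x \<in> range P" for x
  proof -
    have "Q (SB x) = x" using B.Q_S that ran by blast
    then show ?thesis using N(2)[of "SB x"] by simp
  qed
  with N(1) show thesis using that by blast
qed

text \<open>\<open>SB P\<close> inverts \<open>SA Q = I + K\<close> and is bounded by the comparison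
  of the two roots, so \<open>SB P - I = - SB P K\<close> is compact.\<close>

lemma inverse_root_compact_sym:
  assumes "inverse_root P SA" "inverse_root Q SB" and ran: "range Q = range P"
    and K: "compact_operator (\<lambda>y. SA (Q y) - y)"
  shows "compact_operator (\<lambda>y. SB (P y) - y)"
proof -
  interpret A: inverse_root P SA by fact
  interpret B: inverse_root Q SB by fact
  obtain N where N: "N > 0" "\<And>x. x \<in> range P \<Longrightarrow> norm (SB x) \<le> N * norm (SA x)"
    using inverse_root_pair_bounds[OF assms] by blast
  have PQ: "P y \<in> range Q" for y using ran by blast
  have "bounded_linear (\<lambda>y. - SB (P y))"
  proof (rule bounded_linear_intro[of _ N])
    show "- SB (P (x + y)) = - SB (P x) + - SB (P y)" for x y
      by (simp add: linear_add[OF A.linear_Q] B.S_add[OF PQ PQ])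
    show "- SB (P (c *\<^sub>R x)) = c *\<^sub>R - SB (P x)" for c x
      by (simp add: linear_scale[OF A.linear_Q] B.S_scale[OF PQ])
    show "norm (- SB (P x)) \<le> norm x * N" for x
      using N(2)[of "P x"] by (simp add: mult.commute)
  qed
  from compact_operator_comp_bounded[OF K this]
  have "compact_operator (\<lambda>y. - SB (P (SA (Q y) - y)))" .
  moreover have "- SB (P (SA (Q y) - y)) = SB (P y) - y" for y
  proof -
    have "P (SA (Q y)) = Q y" using A.Q_S ran by blast
    then have "P (SA (Q y) - y) = Q y - P y" by (simp add: linear_diff[OF A.linear_Q])
    then show ?thesis by (simp add: B.S_diff[OF rangeI PQ])
  qed
  ultimately show ?thesis by simp
qed

text \<open>One inclusion, stated so that exchanging the two operators gives the other.\<close>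

lemma lim_ess_spec_subset:
  fixes A B :: "'a::{real_inner, complete_space} \<Rightarrow> 'a"
  assumes iA: "inverse_root P (sqrt_map DA A a)" and iB: "inverse_root Q (sqrt_map DB B a)"
    and ran: "range Q = range P"
    and K: "compact_operator (\<lambda>y. sqrt_map DA A a (Q y) - y)"
    and L: "\<And>n. finite_dim_subspace (L n)" "\<And>n. L n \<subseteq> range P"
  shows "lim_ess_spec DA A a L \<subseteq> lim_ess_spec DB B a L"
proof
  fix l assume "l \<in> lim_ess_spec DA A a L"
  then obtain n x where n: "filterlim n at_top sequentially"
    and x: "\<And>k. x k \<in> L (n k)" "\<And>k. norm (x k) = 1"
    and xwk: "\<And>y. (\<lambda>k. inner (x k) y) \<longlonglongrightarrow> 0"
    and xres: "(\<lambda>k. compression DA A a L (n k) (x k) - l *\<^sub>R x k) \<longlonglongrightarrow> 0"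
    unfolding lim_ess_spec_def by blast
  define SA where "SA = sqrt_map DA A a"
  define SB where "SB = sqrt_map DB B a"
  interpret A: inverse_root P SA using iA by (simp add: SA_def)
  interpret B: inverse_root Q SB using iB by (simp add: SB_def)
  define KK where "KK y = SA (Q y) - y" for y
  have K: "compact_operator KK" using K by (simp add: KK_def[abs_def] SA_def)
  obtain N where N: "N > 0" "\<And>x. x \<in> range P \<Longrightarrow> norm (SB x) \<le> N * norm (SA x)"
    using inverse_root_pair_bounds[OF A.inverse_root_axioms B.inverse_root_axioms ran] K
    unfolding KK_def[abs_def] by blast
  define r where "r k = compression DA A a L (n k) (x k) - l *\<^sub>R x k" for k
  have r0: "r \<longlonglongrightarrow> 0" using xres by (simp add: r_def[abs_def])
  have subL: "subspace (L m)" for m by (rule finite_dim_subspace_imp_subspace[OF L(1)])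
  have LP: "y \<in> range P" and LQ: "y \<in> range Q" if "y \<in> L m" for y m
    using L(2) ran that by blast+
  have formA: "inner (SA y) (SA (x k)) = (l - a) * inner y (x k) + inner y (r k)"
    if "y \<in> L (n k)" for y k
    using inner_compression[of P DA A a L "n k", OF iA L(1) L(2) x(1) that]
    by (simp add: r_def SA_def inner_diff_right algebra_simps)
  obtain C where C: "\<And>k. norm (r k) \<le> C"
    using Bseq_def[of r] convergent_imp_Bseq[OF convergentI[OF r0]] by blast
  have "norm (SA (x k)) \<le> sqrt (\<bar>l - a\<bar> + C)" for k
  proof -
    have "(norm (SA (x k)))\<^sup>2 = (l - a) * inner (x k) (x k) + inner (x k) (r k)"
      unfolding power2_norm_eq_inner by (rule formA[OF x(1)])
    also have "\<dots> \<le> \<bar>l - a\<bar> + C"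
      using norm_cauchy_schwarz[of "x k" "r k"] C[of k] x(2)[of k]
      by (simp flip: power2_norm_eq_inner)
    finally show ?thesis by (simp add: real_le_rsqrt)
  qed
  then obtain MA where MA: "\<And>k. norm (SA (x k)) \<le> MA" by blast
  have MB: "norm (SB (x k)) \<le> N * MA" for k
    using N(2)[OF LP[OF x(1)[of k]]] mult_left_mono[OF MA[of k], of N] N(1) by linarith
  \<comment> \<open>For test vectors in the dense form domain, symmetry moves the root off
    \<open>x k\<close>, and weak nullity of \<open>x k\<close> applies.\<close>
  have wkA: "(\<lambda>k. inner (SA (x k)) y) \<longlonglongrightarrow> 0" for y
    by (rule weakly_null_if_on_dense[OF A.dense_range_Q MA])
       (use xwk A.S_symmetric[OF LP[OF x(1)]] in simp)
  have wkB: "(\<lambda>k. inner (SB (x k)) y) \<longlonglongrightarrow> 0" for y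
    by (rule weakly_null_if_on_dense[OF B.dense_range_Q MB])
       (use xwk B.S_symmetric[OF LQ[OF x(1)]] in simp)
  have K0: "(\<lambda>k. KK (SB (x k))) \<longlonglongrightarrow> 0"
  proof (rule compact_operator_weakly_null[OF K MB A.dense_range_Q])
    fix y assume "y \<in> range P"
    then obtain v where v: "y = P v" by blast
    \<comment> \<open>The adjoint of \<open>KK\<close> computed by hand on the dense subspace
      \<open>range P\<close>: it sends \<open>P v\<close> to \<open>Q v - P v\<close>.\<close>
    have "inner (KK u) y = inner u (Q v) - inner u y" for u
      using A.S_symmetric[of "Q u" y] ran by (auto simp: KK_def v inner_diff_left B.symmetric_Q)
    moreover have "(\<lambda>k. inner (SB (x k)) (Q v) - inner (SB (x k)) y) \<longlonglongrightarrow> 0 - 0"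
      by (intro tendsto_diff wkB)
    ultimately show "(\<lambda>k. inner (KK (SB (x k))) y) \<longlonglongrightarrow> 0" by simp
  qed
  \<comment> \<open>The new singular sequence \<open>z k\<close> solves \<open>(B\<^sub>n - a) z = (l - a) x\<close> in \<open>L (n k)\<close>.\<close>
  have "\<exists>z. z \<in> L (n k) \<and> (\<forall>y\<in>L (n k). inner (SB y) (SB z) = (l - a) * inner y (x k))" for k
    using B.form_Riesz[OF L(1) subset_trans[OF L(2) equalityD2[OF ran]]] by metis
  then obtain z where z: "\<And>k. z k \<in> L (n k)"
    "\<And>k y. y \<in> L (n k) \<Longrightarrow> inner (SB y) (SB (z k)) = (l - a) * inner y (x k)"
    by metis
  define e where "e k = z k - x k" for k
  define w where "w k = SB (e k)" for k
  have eL: "e k \<in> L (n k)" for k unfolding e_def using subspace_diff[OF subL z(1) x(1)] .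
  have SA_SB: "SA y = SB y + KK (SB y)" if "y \<in> L m" for y m
    using B.Q_S[OF LQ[OF that]] by (simp add: KK_def)
  \<comment> \<open>The equation for \<open>z k\<close> and the form identity for \<open>A\<close>
    turn the pairing of \<open>SB (e k)\<close> with \<open>SB (z k)\<close> into that of
    \<open>SA (e k)\<close> with \<open>SA (x k)\<close>, less a residual term. Splitting
    \<open>SA = SB + KK SB\<close> in both arguments cancels the main terms.\<close>
  have w2: "(norm (w k))\<^sup>2 = inner (KK (w k)) (SA (x k)) + inner (w k) (KK (SB (x k))) - inner (e k) (r k)"
    for k
  proof -
    have "w k = SB (z k) - SB (x k)" unfolding w_def e_def by (rule B.S_diff[OF LQ[OF z(1)] LQ[OF x(1)]])
    then have "inner (w k) (w k) = inner (SB (e k)) (SB (z k)) - inner (w k) (SB (x k))"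
      by (metis inner_diff_right w_def)
    also have "\<dots> = inner (SA (e k)) (SA (x k)) - inner (e k) (r k) - inner (w k) (SB (x k))"
      using z(2)[OF eL, of k] formA[OF eL, of k] by simp
    also have "inner (SA (e k)) (SA (x k)) = inner (KK (w k)) (SA (x k)) + inner (w k) (SA (x k))"
      using SA_SB[OF eL, of k] by (simp add: w_def inner_add_left)
    also have "inner (w k) (SA (x k)) = inner (w k) (SB (x k)) + inner (w k) (KK (SB (x k)))"
      using SA_SB[OF x(1), of k] by (simp add: inner_add_right)
    finally show ?thesis by (simp add: power2_norm_eq_inner)
  qed
  obtain M where M: "M > 0" "\<And>y. norm (Q y) \<le> norm y * M"
    using bounded_linear.pos_bounded[OF B.bounded_linear_Q] by blast
  have e_w: "norm (e k) \<le> norm (w k) * M" for k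
    using M(2)[of "w k"] B.Q_S[OF LQ[OF eL[of k]]] by (simp add: w_def)
  obtain d where d: "d \<longlonglongrightarrow> 0" "\<And>k. inner (KK (w k)) (SA (x k)) \<le> d k * norm (w k)"
    using compact_operator_form_weakly_null[OF K MA wkA] by blast
  \<comment> \<open>Every term of the identity is at most \<open>norm (w k)\<close> times a null
    sequence, since \<open>e k = Q (w k)\<close>; one factor \<open>norm (w k)\<close> is then
    cancelled.\<close>
  have w_le: "norm (w k) \<le> \<bar>d k\<bar> + norm (KK (SB (x k))) + M * norm (r k)" for k
  proof -
    have "norm (w k) * norm (w k) \<le> d k * norm (w k) + norm (w k) * norm (KK (SB (x k)))
        + norm (e k) * norm (r k)"
      using w2[of k] d(2)[of k] norm_cauchy_schwarz[of "w k" "KK (SB (x k))"]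
        Cauchy_Schwarz_ineq2[of "e k" "r k"] unfolding power2_eq_square by linarith
    also have "\<dots> \<le> \<bar>d k\<bar> * norm (w k) + norm (w k) * norm (KK (SB (x k)))
        + (norm (w k) * M) * norm (r k)"
      by (intro add_mono mult_right_mono e_w) auto
    finally have "norm (w k) * norm (w k) \<le> norm (w k) * (\<bar>d k\<bar> + norm (KK (SB (x k))) + M * norm (r k))"
      by (simp add: algebra_simps)
    then show ?thesis
      using M(1) by (cases "w k = 0") (simp_all add: mult_le_cancel_left_pos)
  qed
  have "w \<longlonglongrightarrow> 0"
  proof (rule tendsto_norm_zero_cancel, rule tendsto_sandwich[OF _ _ tendsto_const])
    have "(\<lambda>k. \<bar>d k\<bar> + norm (KK (SB (x k))) + M * norm (r k)) \<longlonglongrightarrow> \<bar>0\<bar> + norm (0::'a) + M * norm (0::'a)"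
      by (intro tendsto_intros d K0 r0)
    then show "(\<lambda>k. \<bar>d k\<bar> + norm (KK (SB (x k))) + M * norm (r k)) \<longlonglongrightarrow> 0" by simp
  qed (use w_le in auto)
  then have "(\<lambda>k. Q (w k)) \<longlonglongrightarrow> Q 0" by (rule bounded_linear.tendsto[OF B.bounded_linear_Q])
  then have e0: "e \<longlonglongrightarrow> 0"
    using B.Q_S[OF LQ[OF eL]] by (simp add: w_def linear_0[OF B.linear_Q])
  have zx: "z k = x k + e k" for k by (simp add: e_def)
  \<comment> \<open>From \<open>k0\<close> on, \<open>z k\<close> has norm at least 1/2; shifting
    the index by \<open>k0\<close> makes every term normalisable with factors at most 2.\<close>
  obtain k0 where k0: "\<And>k. k \<ge> k0 \<Longrightarrow> norm (e k) < 1 / 2"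
    using LIMSEQ_D[OF e0, of "1 / 2"] by auto
  have zn: "norm (z (k + k0)) \<ge> 1 / 2" for k
    using k0[of "k + k0"] norm_diff_ineq[of "x (k + k0)" "e (k + k0)"] x(2)[of "k + k0"]
    by (simp add: zx)
  define c where "c k = 1 / norm (z (k + k0))" for k
  have c: "0 < c k" "c k \<le> 2" for k
  proof -
    have "norm (z (k + k0)) > 0" using zn[of k] by linarith
    then show "0 < c k" "c k \<le> 2" using zn[of k] by (simp_all add: c_def pos_divide_le_eq)
  qed
  have cv: "(\<lambda>k. c k *\<^sub>R v k) \<longlonglongrightarrow> 0" if v: "v \<longlonglongrightarrow> 0"
    for v :: "nat \<Rightarrow> 'b::real_normed_vector"
  proof (rule Lim_null_comparison)
    show "\<forall>\<^sub>F k in sequentially. norm (c k *\<^sub>R v k) \<le> 2 * norm (v k)"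
      using c by (auto intro!: always_eventually mult_right_mono simp: less_imp_le)
    show "(\<lambda>k. 2 * norm (v k)) \<longlonglongrightarrow> 0"
      using tendsto_mult_right_zero[OF tendsto_norm_zero[OF v]] .
  qed
  define m where "m k = n (k + k0)" for k
  define y where "y k = c k *\<^sub>R z (k + k0)" for k
  have yL: "y k \<in> L (m k)" for k
    unfolding y_def m_def by (rule subspace_scale[OF subL z(1)])
  \<comment> \<open>Up to the normalising factor, the equation for \<open>z\<close> says that the
    compression of \<open>B\<close> sends \<open>z\<close> to
    \<open>a z + (l - a) x\<close>.\<close>
  have comp: "compression DB B a L (m k) (y k) = c k *\<^sub>R (a *\<^sub>R z (k + k0) + (l - a) *\<^sub>R x (k + k0))" for k
  proof (rule compression_eqI[of L "m k", OF subL])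
    show "c k *\<^sub>R (a *\<^sub>R z (k + k0) + (l - a) *\<^sub>R x (k + k0)) \<in> L (m k)"
      unfolding m_def by (intro subspace_scale[OF subL] subspace_add[OF subL] z(1) x(1))
    fix v assume v: "v \<in> L (m k)"
    have "inner (SB v) (SB (y k)) = c k * ((l - a) * inner v (x (k + k0)))"
      using z(2)[of v "k + k0"] v by (simp add: y_def B.S_scale[OF LQ[OF z(1)]] m_def)
    then show "inner v (c k *\<^sub>R (a *\<^sub>R z (k + k0) + (l - a) *\<^sub>R x (k + k0)))
        = inner (sqrt_map DB B a v) (sqrt_map DB B a (y k)) + a * inner v (y k)"
      by (simp add: y_def inner_add_right algebra_simps flip: SB_def)
  qed
  show "l \<in> lim_ess_spec DB B a L"
    unfolding lim_ess_spec_def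
  proof (intro CollectI exI conjI allI)
    show "filterlim m at_top sequentially"
      unfolding m_def using n filterlim_compose[OF n filterlim_add_const_nat_at_top] by simp
    show "y k \<in> L (m k)" for k by (rule yL)
    show "norm (y k) = 1" for k using c(1)[of k] by (auto simp: y_def c_def)
    show "(\<lambda>k. inner (y k) v) \<longlonglongrightarrow> 0" for v
    proof -
      have "(\<lambda>k. inner (x k) v + inner (e k) v) \<longlonglongrightarrow> 0 + inner 0 v"
        by (intro tendsto_add xwk tendsto_inner e0 tendsto_const)
      then have "(\<lambda>k. inner (z k) v) \<longlonglongrightarrow> 0" by (simp add: zx inner_add_left)
      from cv[OF LIMSEQ_ignore_initial_segment[OF this, of k0]] show ?thesis by (simp add: y_def)
    qed
    \<comment> \<open>Before normalisation the residual for \<open>B\<close> is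
      \<open>a z + (l - a) x - l z = (a - l) e\<close>.\<close>
    have "(\<lambda>k. (a - l) *\<^sub>R e k) \<longlonglongrightarrow> (a - l) *\<^sub>R 0" by (intro tendsto_intros e0)
    then have "(\<lambda>k. (a - l) *\<^sub>R e k) \<longlonglongrightarrow> 0" by simp
    from cv[OF LIMSEQ_ignore_initial_segment[OF this, of k0]]
    show "(\<lambda>k. compression DB B a L (m k) (y k) - l *\<^sub>R y k) \<longlonglongrightarrow> 0"
      unfolding comp by (simp add: y_def e_def algebra_simps)
  qed
qed

theorem theorem5p1:
  fixes J :: "'a::{real_inner, complete_space} \<Rightarrow> 'a"
    and DA DB :: "'a set" and A B :: "'a \<Rightarrow> 'a" and a :: real
  assumes "separable_space TYPE('a)"
    and "infinite_dimensional TYPE('a)"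
    and "complex_structure J"
    and "selfadjoint_op DA A" and "commutes_with J DA A" and "bounded_below_op DA A"
    and "selfadjoint_op DB B" and "commutes_with J DB B" and "bounded_below_op DB B"
    and "a < Inf (op_spectrum DA A \<union> op_spectrum DB B)"
    and "sqrt_dom DB B a = sqrt_dom DA A a"
    and "compact_operator
           (\<lambda>y. sqrt_map DA A a (inv_sqrt_map DB B a y - inv_sqrt_map DA A a y))"
  shows "\<forall>L. ((\<forall>n. J ` L n \<subseteq> L n)
              \<and> regular_seq (sqrt_dom DA A a) (sqrt_map DA A a) L
              \<and> regular_seq (sqrt_dom DB B a) (sqrt_map DB B a) L)
           \<longrightarrow> lim_ess_spec DA A a L = lim_ess_spec DB B a L"
proof -
  have nontriv: "\<exists>x::'a. x \<noteq> 0"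
  proof (rule ccontr)
    assume "\<nexists>x::'a. x \<noteq> 0"
    then have "span {} = (UNIV :: 'a set)" by (auto simp: span_empty)
    then show False using assms(2) unfolding infinite_dimensional_def by blast
  qed
  obtain cA where cA: "\<And>x. x \<in> DA \<Longrightarrow> cA * (norm x)\<^sup>2 \<le> inner x (A x)"
    using assms(6) unfolding bounded_below_op_def by blast
  obtain cB where cB: "\<And>x. x \<in> DB \<Longrightarrow> cB * (norm x)\<^sup>2 \<le> inner x (B x)"
    using assms(9) unfolding bounded_below_op_def by blast
  \<comment> \<open>Boundedness of both spectra from below makes \<open>Inf\<close> a true lower
    bound, so that every \<open>l \<le> a\<close> is a resolvent point of both operators.\<close>
  have "bdd_below (op_spectrum DA A)"
    using lower_bound_imp_not_in_spectrum[OF assms(4) cA] by (intro bdd_belowI[of _ cA]) force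
  moreover have "bdd_below (op_spectrum DB B)"
    using lower_bound_imp_not_in_spectrum[OF assms(7) cB] by (intro bdd_belowI[of _ cB]) force
  ultimately have bdd: "bdd_below (op_spectrum DA A \<union> op_spectrum DB B)" by simp
  have res: "l \<notin> op_spectrum DA A \<union> op_spectrum DB B" if "l \<le> a" for l
    using cInf_lower[OF _ bdd, of l] assms(10) that by linarith
  obtain dA where "dA > a" "\<And>x. x \<in> DA \<Longrightarrow> dA * (norm x)\<^sup>2 \<le> inner x (A x)"
    using lower_bound_above_resolvent_halfline[OF assms(4,6) nontriv, of a] res by blast
  from op_sqrt_inverse_root[OF assms(4) this]
  obtain P where P: "inverse_root P (sqrt_map DA A a)" "sqrt_dom DA A a = range P"
    "inv_sqrt_map DA A a = P" by blast
  obtain dB where "dB > a" "\<And>x. x \<in> DB \<Longrightarrow> dB * (norm x)\<^sup>2 \<le> inner x (B x)"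
    using lower_bound_above_resolvent_halfline[OF assms(7,9) nontriv, of a] res by blast
  from op_sqrt_inverse_root[OF assms(7) this]
  obtain Q where Q: "inverse_root Q (sqrt_map DB B a)" "sqrt_dom DB B a = range Q"
    "inv_sqrt_map DB B a = Q" by blast
  interpret A: inverse_root P "sqrt_map DA A a" by (rule P(1))
  have ran: "range Q = range P" using assms(11) P(2) Q(2) by simp
  \<comment> \<open>Both terms lie in the domain of the root, so it may be applied to each; since it
    inverts \<open>P\<close>, the compact operator becomes the root of \<open>A\<close> after
    \<open>Q\<close>, minus the identity.\<close>
  have "Q y \<in> range P" for y using ran by blast
  then have K: "compact_operator (\<lambda>y. sqrt_map DA A a (Q y) - y)"
    using assms(12) by (simp add: P(3) Q(3) A.S_diff)
  note K' = inverse_root_compact_sym[OF P(1) Q(1) ran K]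
  show ?thesis
  proof (intro allI impI, elim conjE)
    fix L assume "regular_seq (sqrt_dom DA A a) (sqrt_map DA A a) L"
    then have L: "finite_dim_subspace (L n)" "L n \<subseteq> range P" "L n \<subseteq> range Q" for n
      unfolding regular_seq_def P(2) ran by blast+
    show "lim_ess_spec DA A a L = lim_ess_spec DB B a L"
      by (intro equalityI lim_ess_spec_subset[OF P(1) Q(1) ran K L(1,2)]
          lim_ess_spec_subset[OF Q(1) P(1) ran[symmetric] K' L(1,3)])
  qed
qed

end
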